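(* Let $0<|\xi|^2<g[[\rho_0]]/\sigma$ be fixed, and let $\mathcal S=\{s\in(0,\infty):\mu(s)<0\}$. Then there exists a unique $s\in\mathcal S$ such that $\lambda(|\xi|,s):=\sqrt{-\mu(s)}>0$ and $$s=\lambda(|\xi|,s).$$
   Context: Parameters and steady state. Fix $g>0$, $\sigma\ge 0$, $m,\ell>0$. Let $P_\pm\in C^\infty((0,\infty))$ be positive and strictly increasing with $1/P_\pm'\in L^\infty_{loc}((0,\infty))$; let $\varepsilon_\pm,\delta_\pm\in C^\infty((0,\infty))$ with $\varepsilon_\pm>0$, $\delta_\pm\ge0$. Put $h_\pm(z)=\int_1^z P_\pm'(r)/r\,dr$. Assume $Z=\{z>0: P_-(z)>P_+(z),\ P_-(z)\in P_+((0,\infty))\}$ is nonempty, fix $\rho_0^-\in Z$ and set $\rho_0^+=P_+^{-1}(P_-(\rho_0^-))$. Assume $h_-(\rho_0^-)+gm\in h_-((0,\infty))$ and $h_+(\rho_0^+)-g\ell\in h_+((0,\infty))$. Define $\rho_0(x_3)=h_-^{-1}(h_-(\rho_0^-)-gx_3)$ for $-m<x_3<0$ and $\rho_0(x_3)=h_+^{-1}(h_+(\rho_0^+)-gx_3)$ for $0<x_3<\ell$; then $\rho_0$ is smooth on each side, bounded above and below by positive constants, and $\frac{d}{dx_3}P(\rho_0)=-g\rho_0$ on each side. Notation. $P'(\rho_0)$, $\varepsilon_0=\varepsilon(\rho_0)$, $\delta_0=\delta(\rho_0)$ mean the $+$ functions of $\rho_0$ for $x_3>0$ and the $-$ functions for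 $x_3<0$. $[[\rho_0]]=\rho_0^+-\rho_0^->0$. Convention: $g[[\rho_0]]/\sigma=+\infty$ if $\sigma=0$. Variational quantities. For fixed $|\xi|>0$ and $s>0$, with $\tilde\varepsilon=s\varepsilon_0$, $\tilde\delta=s\delta_0$ and real $\varphi,\psi\in H^1_0((-m,\ell))$, let $$E(\varphi,\psi;s)=\frac{\sigma|\xi|^2}{2}\psi(0)^2+\frac12\int_{-m}^\ell(\tilde\delta+P'(\rho_0)\rho_0)(\psi'+|\xi|\varphi)^2-2g\rho_0|\xi|\varphi\psi+\frac12\int_{-m}^\ell\tilde\varepsilon\left((\varphi'-|\xi|\psi)^2+(\psi'-|\xi|\varphi)^2+\tfrac13(\psi'+|\xi|\varphi)^2\right),$$ $J(\varphi,\psi)=\frac12\int_{-m}^\ell\rho_0(\varphi^2+\psi^2)$, $\mathcal A=\{(\varphi,\psi)\in H_0^1((-m,\ell))\times H_0^1((-m,\ell)): J(\varphi,\psi)=1\}$, and $\mu(s)=\inf_{(\varphi,\psi)\in\mathcal A}E(\varphi,\psi;s)$. *)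

theory Defs
  imports "HOL-Analysis.Analysis"
begin

text \<open>Used only for open \<open>S\<close>, so the values of \<open>f\<close> outside \<open>S\<close> are irrelevant.\<close>

definition smooth_on :: "real set \<Rightarrow> (real \<Rightarrow> real) \<Rightarrow> bool" where
  "smooth_on S f \<longleftrightarrow> (\<forall>k. \<forall>x\<in>S. ((deriv ^^ k) f) differentiable (at x))"

text \<open>For a smooth, strictly increasing \<open>P\<close>, membership of \<open>1 / deriv P\<close> in \<open>Linf_loc {0<..}\<close> does
  exclude zeros of \<open>deriv P\<close>, despite \<open>1 / 0 = 0\<close>: the derivative vanishes on no open interval, so
  near a zero \<open>1 / deriv P\<close> is arbitrarily large on open sets.\<close>

definition Linf_loc :: "real set \<Rightarrow> (real \<Rightarrow> real) set" where
  "Linf_loc S = {f. \<forall>K. compact K \<and> K \<subseteq> S \<longrightarrow>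
     f \<in> borel_measurable (lebesgue_on K) \<and> (\<exists>C. AE x in lebesgue_on K. \<bar>f x\<bar> \<le> C)}"


section \<open>The Sobolev space \<open>H\<^sup>1\<^sub>0\<close> of a bounded open interval\<close>

definition test_function :: "real \<Rightarrow> real \<Rightarrow> (real \<Rightarrow> real) \<Rightarrow> bool" where
  "test_function a b \<phi> \<longleftrightarrow> smooth_on UNIV \<phi> \<and>
     (\<exists>K. compact K \<and> K \<subseteq> {a<..<b} \<and> (\<forall>x. x \<notin> K \<longrightarrow> \<phi> x = 0))"

definition L2 :: "real \<Rightarrow> real \<Rightarrow> (real \<Rightarrow> real) set" where
  "L2 a b = {u. u \<in> borel_measurable (lebesgue_on {a<..<b}) \<and>
     integrable (lebesgue_on {a<..<b}) (\<lambda>x. (u x)\<^sup>2)}"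

definition has_weak_deriv :: "real \<Rightarrow> real \<Rightarrow> (real \<Rightarrow> real) \<Rightarrow> (real \<Rightarrow> real) \<Rightarrow> bool" where
  "has_weak_deriv a b u w \<longleftrightarrow>
     (\<forall>\<phi>. test_function a b \<phi> \<longrightarrow>
       (LINT x|lebesgue_on {a<..<b}. u x * deriv \<phi> x) =
       - (LINT x|lebesgue_on {a<..<b}. w x * \<phi> x))"

definition H1 :: "real \<Rightarrow> real \<Rightarrow> (real \<Rightarrow> real) set" where
  "H1 a b = {u \<in> L2 a b. \<exists>w\<in>L2 a b. has_weak_deriv a b u w}"

text \<open>A weak derivative is unique only up to null sets; \<open>weak_deriv\<close> picks a representative and
  occurs below only under integrals over \<open>{a<..<b}\<close>.\<close>

definition weak_deriv :: "real \<Rightarrow> real \<Rightarrow> (real \<Rightarrow> real) \<Rightarrow> real \<Rightarrow> real" where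
  "weak_deriv a b u = (SOME w. w \<in> L2 a b \<and> has_weak_deriv a b u w)"

definition H1_norm :: "real \<Rightarrow> real \<Rightarrow> (real \<Rightarrow> real) \<Rightarrow> real" where
  "H1_norm a b u = sqrt ((LINT x|lebesgue_on {a<..<b}. (u x)\<^sup>2) +
                         (LINT x|lebesgue_on {a<..<b}. (weak_deriv a b u x)\<^sup>2))"

text \<open>The closure of the test functions in \<open>H1\<close>. Each class of almost everywhere equal functions is
  represented by its continuous member, so that point values of an element are meaningful.\<close>

definition H10 :: "real \<Rightarrow> real \<Rightarrow> (real \<Rightarrow> real) set" where
  "H10 a b = {u \<in> H1 a b. continuous_on {a<..<b} u \<and>
     (\<exists>\<phi>. (\<forall>n. test_function a b (\<phi> n)) \<and>
          (\<lambda>n. H1_norm a b (\<lambda>x. u x - \<phi> n x)) \<longlonglongrightarrow> 0)}"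


section \<open>The steady state\<close>

text \<open>For \<open>z < 1\<close> the interval integral is the signed one.\<close>

definition enthalpy :: "(real \<Rightarrow> real) \<Rightarrow> real \<Rightarrow> real" where
  "enthalpy P z = (LBINT r=1..z. deriv P r / r)"

text \<open>\<open>two_sided fm fp\<close> is \<open>fm\<close> below and \<open>fp\<close> above the interface at height 0; the value at 0
  itself plays no role.\<close>

definition two_sided :: "(real \<Rightarrow> 'a) \<Rightarrow> (real \<Rightarrow> 'a) \<Rightarrow> real \<Rightarrow> 'a" where
  "two_sided fm fp x = (if x < 0 then fm x else fp x)"

definition steady_density ::
    "real \<Rightarrow> (real \<Rightarrow> real) \<Rightarrow> (real \<Rightarrow> real) \<Rightarrow> real \<Rightarrow> real \<Rightarrow> real \<Rightarrow> real" where
  "steady_density g Pm Pp \<rho>m \<rho>p =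
     two_sided
       (\<lambda>x. inv_into {0<..} (enthalpy Pm) (enthalpy Pm \<rho>m - g * x))
       (\<lambda>x. inv_into {0<..} (enthalpy Pp) (enthalpy Pp \<rho>p - g * x))"

definition critical_sq :: "real \<Rightarrow> real \<Rightarrow> real \<Rightarrow> ereal" where
  "critical_sq g \<sigma> jump = (if \<sigma> = 0 then \<infinity> else ereal (g * jump / \<sigma>))"


section \<open>The variational problem\<close>

text \<open>\<open>dP\<close>, \<open>\<epsilon>\<close>, \<open>\<delta>\<close> are \<open>P'(\<rho>\<^sub>0)\<close>, \<open>\<epsilon>(\<rho>\<^sub>0)\<close>, \<open>\<delta>(\<rho>\<^sub>0)\<close> as functions of the height, and
  \<open>k\<close> is the modulus of the frequency.\<close>

definition energy ::
    "real \<Rightarrow> real \<Rightarrow> real \<Rightarrow> real \<Rightarrow> (real \<Rightarrow> real) \<Rightarrow> (real \<Rightarrow> real) \<Rightarrow> (real \<Rightarrow> real) \<Rightarrow> (real \<Rightarrow> real)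
      \<Rightarrow> real \<Rightarrow> real \<Rightarrow> (real \<Rightarrow> real) \<Rightarrow> (real \<Rightarrow> real) \<Rightarrow> real" where
  "energy g \<sigma> m l \<rho>0 dP \<epsilon> \<delta> k s \<phi> \<psi> =
    (let \<phi>' = weak_deriv (-m) l \<phi>; \<psi>' = weak_deriv (-m) l \<psi> in
     \<sigma> * k\<^sup>2 / 2 * (\<psi> 0)\<^sup>2
     + 1/2 * (LINT x|lebesgue_on {-m<..<l}.
         (s * \<delta> x + dP x * \<rho>0 x) * (\<psi>' x + k * \<phi> x)\<^sup>2 - 2 * g * \<rho>0 x * k * \<phi> x * \<psi> x)
     + 1/2 * (LINT x|lebesgue_on {-m<..<l}.
         s * \<epsilon> x * ((\<phi>' x - k * \<psi> x)\<^sup>2 + (\<psi>' x - k * \<phi> x)\<^sup>2 + 1/3 * (\<psi>' x + k * \<phi> x)\<^sup>2)))"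

definition mass ::
    "real \<Rightarrow> real \<Rightarrow> (real \<Rightarrow> real) \<Rightarrow> (real \<Rightarrow> real) \<Rightarrow> (real \<Rightarrow> real) \<Rightarrow> real" where
  "mass m l \<rho>0 \<phi> \<psi> =
     1/2 * (LINT x|lebesgue_on {-m<..<l}. \<rho>0 x * ((\<phi> x)\<^sup>2 + (\<psi> x)\<^sup>2))"

definition admissible ::
    "real \<Rightarrow> real \<Rightarrow> (real \<Rightarrow> real) \<Rightarrow> ((real \<Rightarrow> real) \<times> (real \<Rightarrow> real)) set" where
  "admissible m l \<rho>0 = {(\<phi>, \<psi>). \<phi> \<in> H10 (-m) l \<and> \<psi> \<in> H10 (-m) l \<and> mass m l \<rho>0 \<phi> \<psi> = 1}"

text \<open>A real infimum: \<open>admissible\<close> is nonempty, and on it the energy is at least \<open>- g * k\<close>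
  because \<open>2 * \<phi> * \<psi> \<le> \<phi>\<^sup>2 + \<psi>\<^sup>2\<close> and the remaining terms are nonnegative.\<close>

definition energy_inf ::
    "real \<Rightarrow> real \<Rightarrow> real \<Rightarrow> real \<Rightarrow> (real \<Rightarrow> real) \<Rightarrow> (real \<Rightarrow> real) \<Rightarrow> (real \<Rightarrow> real) \<Rightarrow> (real \<Rightarrow> real)
      \<Rightarrow> real \<Rightarrow> real \<Rightarrow> real" where
  "energy_inf g \<sigma> m l \<rho>0 dP \<epsilon> \<delta> k s =
     (INF (\<phi>, \<psi>)\<in>admissible m l \<rho>0. energy g \<sigma> m l \<rho>0 dP \<epsilon> \<delta> k s \<phi> \<psi>)"

end

theory Submission
  imports Defs
begin

text \<open>
  The energy is affine in \<open>s\<close>: \<open>E(\<phi>, \<psi>; s) = E(\<phi>, \<psi>; 0) + s D(\<phi>, \<psi>)\<close>, where \<open>D\<close> is the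
  nonnegative viscous dissipation. On the constraint set \<open>E(\<phi>, \<psi>; 0) \<ge> - g |\<xi>|\<close>, by
  \<open>2 \<phi> \<psi> \<le> \<phi>\<^sup>2 + \<psi>\<^sup>2\<close>. Hence \<open>\<mu>\<close>, an infimum of nondecreasing affine functions with a common lower
  bound at \<open>s = 0\<close>, is nondecreasing, concave and so continuous on \<open>{0<..}\<close>, and bounded below. A fixed
  point \<open>s = sqrt (- \<mu> s)\<close> is a zero of the strictly increasing continuous function \<open>\<mu> s + s\<^sup>2\<close>,
  which is positive for large \<open>s\<close>. There is exactly one zero as soon as the function is nonpositive
  for some small \<open>s\<close>, and for this one pair with \<open>E(\<phi>, \<psi>; 0) < 0\<close> suffices
  (\<open>unique_crossing_of_affine_infimum\<close>).

  To find such a pair, take \<open>\<phi> = - \<psi>' / |\<xi>|\<close>, which removes the compression term and leaves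
  \<open>\<sigma> |\<xi>|\<^sup>2 \<psi>(0)\<^sup>2 / 2 + g \<integral> \<rho>\<^sub>0 \<psi> \<psi>'\<close>. If \<open>\<psi>\<close> is a bump of small width that increases up to the
  interface and decreases after it, then \<open>\<rho>\<^sub>0\<close> is close to \<open>\<rho>\<^sub>0\<^sup>-\<close> where \<open>\<psi> \<psi>' \<ge> 0\<close> and close to
  \<open>\<rho>\<^sub>0\<^sup>+\<close> where \<open>\<psi> \<psi>' \<le> 0\<close>, so the integral is about \<open>- [[\<rho>\<^sub>0]] \<psi>(0)\<^sup>2 / 2\<close>. The condition
  \<open>\<sigma> |\<xi>|\<^sup>2 < g [[\<rho>\<^sub>0]]\<close> makes the total negative (\<open>energy_0_negative\<close>).

  Two ingredients make this rigorous. Weak derivatives are unique up to null sets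
  (\<open>weak_deriv_unique\<close>), so on test functions the weak derivative in the energy is the classical
  one; this is the fundamental lemma of the calculus of variations, proved with an explicit family
  of smooth bumps that increases to the indicator of an interval. And the enthalpy is a strictly
  increasing continuous function, so its inverse is continuous and the density is continuous up to
  the interface and bounded away from zero on each side (\<open>density_profile\<close>), which bounds all
  coefficients.
\<close>

section \<open>Smooth bumps\<close>

lemma has_real_derivative_0_if_dominated:
  fixes f h :: "real \<Rightarrow> real"
  assumes h: "(h has_real_derivative 0) (at x)" "h x = 0"
    and le: "\<And>y. \<bar>f y\<bar> \<le> \<bar>h y\<bar>"
  shows "(f has_real_derivative 0) (at x)"
proof -
  have f0: "f x = 0" using le[of x] h(2) by simp
  have lim: "((\<lambda>y. (h y - h x) / (y - x)) \<longlongrightarrow> 0) (at x)"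
    using h(1) by (simp add: has_field_derivative_iff)
  have "((\<lambda>y. (f y - f x) / (y - x)) \<longlongrightarrow> 0) (at x)"
  proof (rule Lim_null_comparison)
    show "\<forall>\<^sub>F y in at x. norm ((f y - f x) / (y - x)) \<le> \<bar>(h y - h x) / (y - x)\<bar>"
      using le by (intro always_eventually allI) (simp add: h f0 divide_right_mono)
    show "((\<lambda>y. \<bar>(h y - h x) / (y - x)\<bar>) \<longlongrightarrow> 0) (at x)"
      using tendsto_rabs[OF lim] by simp
  qed
  then show ?thesis by (simp add: has_field_derivative_iff)
qed

text \<open>On \<open>{x. poly q x > 0}\<close> this family is closed under differentiation: the derivative changes only
  the numerator and the power of \<open>q\<close>. It contains the classical bumps, for quadratic \<open>q\<close>.\<close>

definition flat_exp :: "real poly \<Rightarrow> real \<Rightarrow> real poly \<Rightarrow> nat \<Rightarrow> real \<Rightarrow> real" where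
  "flat_exp q \<tau> p n x = (if poly q x > 0 then poly p x / poly q x ^ n * exp (- \<tau> / poly q x) else 0)"

lemma power_le_fact_mult_exp:
  fixes t :: real
  assumes "t \<ge> 0" shows "t ^ n \<le> fact n * exp t"
proof -
  have "t ^ n / fact n \<le> exp t"
    using sum_le_suminf[OF summable_exp_generic[of t], of "{n}"] assms
    by (simp add: exp_def divide_inverse mult.commute)
  then show ?thesis by (simp add: field_simps)
qed

text \<open>The exponential beats every power of \<open>1 / q\<close>, so the functions vanish to second order at the
  zeros of \<open>q\<close>, whatever \<open>n\<close> is.\<close>

lemma flat_exp_bound:
  assumes "\<tau> > 0"
  shows "\<bar>flat_exp q \<tau> p n x\<bar> \<le> \<bar>fact (n + 2) / \<tau> ^ (n + 2) * poly p x * poly q x ^ 2\<bar>"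
proof (cases "poly q x > 0")
  case True
  define y where "y = poly q x"
  have y: "y > 0" using True by (simp add: y_def)
  have "(\<tau> / y) ^ (n + 2) \<le> fact (n + 2) * exp (\<tau> / y)"
    using y assms by (intro power_le_fact_mult_exp) simp
  then have "\<tau> ^ (n + 2) * exp (- \<tau> / y) \<le> fact (n + 2) * y ^ (n + 2)"
    using y by (simp add: power_divide exp_minus field_simps)
  then have "exp (- \<tau> / y) / y ^ n \<le> fact (n + 2) / \<tau> ^ (n + 2) * y ^ 2"
    using y assms by (simp add: field_simps power_add power2_eq_square)
  then have "\<bar>poly p x\<bar> * (exp (- \<tau> / y) / y ^ n) \<le> \<bar>poly p x\<bar> * (fact (n + 2) / \<tau> ^ (n + 2) * y ^ 2)"
    by (rule mult_left_mono) simp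
  then show ?thesis
    using y assms True by (simp add: flat_exp_def abs_mult y_def[symmetric] mult_ac)
qed (simp add: flat_exp_def)

text \<open>Only the zeros of \<open>q\<close> need an argument: there the quadratic bound forces derivative \<open>0\<close>, which is
  what the formula gives. The new power is \<open>n + 2\<close> because differentiating \<open>- \<tau> / q\<close> costs two
  powers of \<open>q\<close>.\<close>

lemma flat_exp_has_derivative:
  assumes "\<tau> > 0"
  shows "(flat_exp q \<tau> p n has_real_derivative
      flat_exp q \<tau> (pderiv p * q ^ 2 - smult (of_nat n) (p * pderiv q * q) + smult \<tau> (p * pderiv q)) (n + 2) x)
      (at x)" (is "(_ has_real_derivative flat_exp _ _ ?r _ _) _")
proof -
  consider "poly q x > 0" | "poly q x < 0" | "poly q x = 0" by linarith
  then show ?thesis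
  proof cases
    case 1
    have D: "((\<lambda>x. poly p x / poly q x ^ n * exp (- \<tau> / poly q x)) has_real_derivative
        flat_exp q \<tau> ?r (n + 2) x) (at x)"
      using 1 unfolding flat_exp_def
      by (cases "n = 0") (auto intro!: derivative_eq_intros simp: field_simps power2_eq_square power_add power_eq_if[of "poly q x" n])
    have "open {y. poly q y > 0}"
      by (intro open_Collect_less continuous_intros)
    then show ?thesis
      using D 1 by (rule_tac DERIV_cong_ev[THEN iffD1, rotated 3, OF D])
       (auto simp: flat_exp_def eventually_nhds intro!: exI[of _ "{y. poly q y > 0}"])
  next
    case 2
    have "open {y. poly q y < 0}"
      by (intro open_Collect_less continuous_intros)
    then show ?thesis
      using 2 by (rule_tac DERIV_cong_ev[THEN iffD1, rotated 3, OF DERIV_const[of 0]])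
       (auto simp: flat_exp_def eventually_nhds intro!: exI[of _ "{y. poly q y < 0}"])
  next
    case 3
    have "(flat_exp q \<tau> p n has_real_derivative 0) (at x)"
    proof (rule has_real_derivative_0_if_dominated)
      show "((\<lambda>y. fact (n + 2) / \<tau> ^ (n + 2) * poly p y * poly q y ^ 2) has_real_derivative 0) (at x)"
        using 3 assms by (auto intro!: derivative_eq_intros)
    qed (use 3 flat_exp_bound[OF assms] in auto)
    then show ?thesis using 3 by (simp add: flat_exp_def)
  qed
qed

lemma smooth_flat_exp:
  assumes "\<tau> > 0" shows "smooth_on UNIV (flat_exp q \<tau> p n)"
proof -
  have "\<exists>p' n'. (deriv ^^ k) (flat_exp q \<tau> p n) = flat_exp q \<tau> p' n'" for k
  proof (induction k)
    case (Suc k)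
    then obtain p' n' where *: "(deriv ^^ k) (flat_exp q \<tau> p n) = flat_exp q \<tau> p' n'" by blast
    show ?case
      by (simp add: *) (use DERIV_imp_deriv[OF flat_exp_has_derivative[OF assms]] in blast)
  qed auto
  then show ?thesis
    unfolding smooth_on_def using flat_exp_has_derivative[OF assms] real_differentiable_def by metis
qed

text \<open>The parameter \<open>\<tau>\<close> flattens the bump: as \<open>\<tau> \<rightarrow> 0\<close> it increases to the indicator of the interval.\<close>

definition bump :: "real \<Rightarrow> real \<Rightarrow> real \<Rightarrow> real \<Rightarrow> real" where
  "bump \<tau> c d x = (if c < x \<and> x < d then exp (- \<tau> / ((x - c) * (d - x))) else 0)"

lemma bump_eq_flat_exp:
  assumes "c < d"
  shows "bump \<tau> c d = flat_exp ([:-c, 1:] * [:d, -1:]) \<tau> 1 0"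
proof
  fix x
  have "(x - c) * (d - x) > 0 \<longleftrightarrow> c < x \<and> x < d"
    using assms by (auto simp: zero_less_mult_iff)
  then show "bump \<tau> c d x = flat_exp ([:-c, 1:] * [:d, -1:]) \<tau> 1 0 x"
    by (auto simp: bump_def flat_exp_def algebra_simps)
qed

lemma test_function_bump:
  assumes "\<tau> > 0" "a < c" "c < d" "d < b"
  shows "test_function a b (bump \<tau> c d)"
  unfolding test_function_def
proof
  show "smooth_on UNIV (bump \<tau> c d)"
    using assms by (simp only: bump_eq_flat_exp smooth_flat_exp)
  show "\<exists>K. compact K \<and> K \<subseteq> {a<..<b} \<and> (\<forall>x. x \<notin> K \<longrightarrow> bump \<tau> c d x = 0)"
    using assms by (intro exI[of _ "{c..d}"]) (auto simp: bump_def)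
qed

lemma bump_bounds:
  assumes "\<tau> \<ge> 0" shows "0 \<le> bump \<tau> c d x" "bump \<tau> c d x \<le> 1"
  using assms by (auto simp: bump_def)

lemma bump_tendsto_indicator:
  "(\<lambda>n. bump (1 / real (Suc n)) c d x) \<longlonglongrightarrow> indicator {c<..<d} x"
proof (cases "c < x \<and> x < d")
  case True
  have "(\<lambda>n. exp (- (1 / real (Suc n)) / ((x - c) * (d - x)))) \<longlonglongrightarrow> exp (- 0 / ((x - c) * (d - x)))"
    using True by (intro tendsto_intros LIMSEQ_Suc lim_1_over_n) auto
  then show ?thesis using True by (simp add: bump_def)
qed (auto simp: bump_def)

section \<open>Test functions and weak derivatives\<close>

lemma borel_measurable_lebesgue_on_continuous:
  fixes f :: "real \<Rightarrow> real"
  assumes "continuous_on {a..b} f"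
  shows "f \<in> borel_measurable (lebesgue_on {a<..<b})"
  using assms by (intro continuous_imp_measurable_on_sets_lebesgue continuous_on_subset[OF assms]) auto

lemma integrable_lebesgue_on_iff_absolutely_integrable_on:
  fixes f :: "real \<Rightarrow> real"
  shows "integrable (lebesgue_on {a<..<b}) f \<longleftrightarrow> f absolutely_integrable_on {a<..<b}"
  by (simp add: integrable_restrict_space set_integrable_def)

lemma integrable_lebesgue_on_continuous:
  fixes f :: "real \<Rightarrow> real"
  assumes "continuous_on {a..b} f"
  shows "integrable (lebesgue_on {a<..<b}) f"
  unfolding integrable_lebesgue_on_iff_absolutely_integrable_on
  by (rule set_integrable_subset[OF absolutely_integrable_continuous_real[OF assms]]) auto

text \<open>Every integrand in the energy is a sum of such products, hence integrable.\<close>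

lemma L2_integrable_mult:
  assumes "u \<in> L2 a b" "v \<in> L2 a b"
    and "c \<in> borel_measurable (lebesgue_on {a<..<b})" "\<And>x. a < x \<Longrightarrow> x < b \<Longrightarrow> \<bar>c x\<bar> \<le> C"
  shows "integrable (lebesgue_on {a<..<b}) (\<lambda>x. c x * (u x * v x))"
proof (rule Bochner_Integration.integrable_bound)
  show "integrable (lebesgue_on {a<..<b}) (\<lambda>x. C * ((u x)\<^sup>2 + (v x)\<^sup>2))"
    using assms by (auto simp: L2_def)
  show "(\<lambda>x. c x * (u x * v x)) \<in> borel_measurable (lebesgue_on {a<..<b})"
    using assms by (auto simp: L2_def)
  show "AE x in lebesgue_on {a<..<b}. norm (c x * (u x * v x)) \<le> norm (C * ((u x)\<^sup>2 + (v x)\<^sup>2))"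
  proof (rule AE_I2)
    fix x assume "x \<in> space (lebesgue_on {a<..<b})"
    then have c: "\<bar>c x\<bar> \<le> C" using assms(4) by simp
    then have C: "C \<ge> 0" by linarith
    have "\<bar>u x * v x\<bar> \<le> (u x)\<^sup>2 + (v x)\<^sup>2"
      using sum_squares_bound[of "\<bar>u x\<bar>" "\<bar>v x\<bar>"] abs_ge_zero[of "u x * v x"]
      unfolding abs_mult power2_abs by linarith
    then have "\<bar>c x\<bar> * \<bar>u x * v x\<bar> \<le> C * ((u x)\<^sup>2 + (v x)\<^sup>2)"
      using c C by (intro mult_mono) auto
    then show "norm (c x * (u x * v x)) \<le> norm (C * ((u x)\<^sup>2 + (v x)\<^sup>2))"
      using C by (simp add: abs_mult)
  qed
qed

lemma L2_continuous: "continuous_on {a..b} u \<Longrightarrow> u \<in> L2 a b"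
  unfolding L2_def
  by (simp add: borel_measurable_lebesgue_on_continuous integrable_lebesgue_on_continuous continuous_on_power)

lemma L2_integrable: "u \<in> L2 a b \<Longrightarrow> integrable (lebesgue_on {a<..<b}) u"
  using L2_integrable_mult[of u a b "\<lambda>_. 1" "\<lambda>_. 1" 1] L2_continuous[of a b "\<lambda>_. 1"] by simp

lemma L2_cmult: "u \<in> L2 a b \<Longrightarrow> (\<lambda>x. c * u x) \<in> L2 a b"
  by (auto simp: L2_def power_mult_distrib)

lemma L2_add:
  assumes "u \<in> L2 a b" "v \<in> L2 a b" shows "(\<lambda>x. u x + v x) \<in> L2 a b"
proof -
  have "integrable (lebesgue_on {a<..<b}) (\<lambda>x. (u x)\<^sup>2 + (v x)\<^sup>2 + 2 * (1 * (u x * v x)))"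
    using assms L2_integrable_mult[OF assms, of "\<lambda>_. 1" 1]
    by (intro Bochner_Integration.integrable_add integrable_mult_right) (auto simp: L2_def)
  then show ?thesis using assms by (auto simp: L2_def power2_sum mult.assoc)
qed

text \<open>By the Lebesgue differentiation theorem, \<open>w\<close> is almost everywhere the limit of its averages over
  short intervals.\<close>

lemma AE_zero_if_interval_integrals_zero:
  fixes w :: "real \<Rightarrow> real"
  assumes w: "integrable (lebesgue_on {a<..<b}) w"
    and zero: "\<And>c d. a < c \<Longrightarrow> c < d \<Longrightarrow> d < b \<Longrightarrow>
      (LINT x|lebesgue_on {a<..<b}. w x * indicator {c<..<d} x) = 0"
  shows "AE x in lebesgue_on {a<..<b}. w x = 0"
proof -
  \<comment> \<open>Extension by zero, because the differentiation theorem is about functions on the whole line.\<close>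
  define f where "f x = (if x \<in> {a<..<b} then w x else 0)" for x
  have "f absolutely_integrable_on UNIV"
    using w unfolding f_def integrable_lebesgue_on_iff_absolutely_integrable_on
    by (subst absolutely_integrable_restrict_UNIV)
  then have "f integrable_on cbox c d" for c d
    using set_integrable_subset[of lebesgue UNIV f "cbox c d"] set_lebesgue_integral_eq_integral(1) by auto
  then obtain N where N: "negligible N"
    and lim: "\<And>x e. \<lbrakk>x \<notin> N; 0 < e\<rbrakk> \<Longrightarrow> \<exists>d>0. \<forall>h. 0 < h \<and> h < d \<longrightarrow>
         norm (integral (cbox x (x + h *\<^sub>R One)) f /\<^sub>R h ^ DIM(real) - f x) < e"
    using integrable_ccontinuous_explicit[of f] by metis
  have int0: "integral {c..d} f = 0" if "a < c" "c < d" "d < b" for c d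
  proof -
    have "integrable (lebesgue_on {a<..<b}) (\<lambda>x. w x * indicator {c<..<d} x)"
      using integrable_mult_indicator[OF _ w, of "{c<..<d}"] that
      by (auto simp: sets_restrict_space_iff subset_iff mult.commute)
    then have "0 = integral {a<..<b} (\<lambda>x. w x * indicator {c<..<d} x)"
      using zero[OF that] by (subst lebesgue_integral_eq_integral[symmetric]) auto
    also have "\<dots> = integral {a<..<b} (\<lambda>x. if x \<in> {c<..<d} then f x else 0)"
      by (intro integral_cong) (auto simp: f_def)
    also have "\<dots> = integral {c<..<d} f"
      using that by (subst integral_restrict_Int) (simp add: Int_absorb2 subset_iff)
    finally show ?thesis by (simp add: integral_open_interval_real)
  qed
  have "w x = 0" if x: "x \<in> {a<..<b}" "x \<notin> N" for x
  proof (rule ccontr)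
    assume "w x \<noteq> 0"
    then obtain d where d: "d > 0" and *: "\<And>h. 0 < h \<Longrightarrow> h < d \<Longrightarrow>
         norm (integral (cbox x (x + h *\<^sub>R One)) f /\<^sub>R h ^ DIM(real) - f x) < \<bar>w x\<bar>"
      using lim[OF x(2), of "\<bar>w x\<bar>"] by auto
    define h where "h = min d (b - x) / 2"
    have "0 < h" "h < d" "x + h < b" using d x by (auto simp: h_def min_def field_simps)
    then show False using *[of h] int0[of x "x + h"] x by (simp add: f_def)
  qed
  moreover have "N \<in> null_sets lebesgue" using N by (simp add: negligible_iff_null_sets)
  ultimately show ?thesis
    by (subst AE_restrict_space_iff) (auto intro!: AE_I'[of N])
qed

lemma test_functionD:
  assumes "test_function a b \<phi>"
  shows "(\<phi> has_real_derivative deriv \<phi> x) (at x)" "continuous_on S \<phi>"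
    "x \<notin> {a<..<b} \<Longrightarrow> \<phi> x = 0"
proof -
  show D: "(\<phi> has_real_derivative deriv \<phi> x) (at x)" for x
    using assms unfolding test_function_def smooth_on_def
    by (metis DERIV_deriv_iff_real_differentiable UNIV_I funpow_0)
  show "continuous_on S \<phi>"
    using D by (meson DERIV_isCont continuous_at_imp_continuous_on)
  show "x \<notin> {a<..<b} \<Longrightarrow> \<phi> x = 0"
    using assms unfolding test_function_def by blast
qed

text \<open>The bumps on \<open>{c<..<d}\<close> converge boundedly to the indicator, so dominated convergence turns the
  orthogonality to test functions into vanishing integrals over intervals.\<close>

lemma fundamental_lemma:
  assumes w: "integrable (lebesgue_on {a<..<b}) w"
    and zero: "\<And>\<phi>. test_function a b \<phi> \<Longrightarrow> (LINT x|lebesgue_on {a<..<b}. w x * \<phi> x) = 0"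
  shows "AE x in lebesgue_on {a<..<b}. w x = 0"
proof (rule AE_zero_if_interval_integrals_zero[OF w])
  fix c d assume cd: "a < c" "c < d" "d < b"
  let ?b = "\<lambda>n. bump (1 / real (Suc n)) c d"
  have "(\<lambda>n. LINT x|lebesgue_on {a<..<b}. w x * ?b n x)
      \<longlonglongrightarrow> (LINT x|lebesgue_on {a<..<b}. w x * indicator {c<..<d} x)"
  proof (rule integral_dominated_convergence[where w = "\<lambda>x. \<bar>w x\<bar>"])
    have "?b n \<in> borel_measurable (lebesgue_on {a<..<b})" for n
      using cd test_function_bump[of "1 / real (Suc n)" a c d b]
      by (intro borel_measurable_lebesgue_on_continuous test_functionD(2)) auto
    then show "(\<lambda>x. w x * ?b n x) \<in> borel_measurable (lebesgue_on {a<..<b})" for n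
      using w by measurable
    show "(\<lambda>x. w x * indicator {c<..<d} x) \<in> borel_measurable (lebesgue_on {a<..<b})"
      using w cd by (intro borel_measurable_times borel_measurable_indicator)
        (auto simp: sets_restrict_space_iff)
    show "AE x in lebesgue_on {a<..<b}. norm (w x * ?b n x) \<le> \<bar>w x\<bar>" for n
      using bump_bounds[of "1 / real (Suc n)" c d]
      by (intro AE_I2) (auto simp: abs_mult intro!: mult_left_le)
    show "AE x in lebesgue_on {a<..<b}. (\<lambda>n. w x * ?b n x) \<longlonglongrightarrow> w x * indicator {c<..<d} x"
      by (intro AE_I2 tendsto_mult tendsto_const bump_tendsto_indicator)
  qed (use w in simp)
  moreover have "(LINT x|lebesgue_on {a<..<b}. w x * ?b n x) = 0" for n
    using cd by (intro zero test_function_bump) auto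
  ultimately show "(LINT x|lebesgue_on {a<..<b}. w x * indicator {c<..<d} x) = 0"
    by (simp add: LIMSEQ_const_iff)
qed

lemma test_function_deriv:
  assumes "test_function a b \<phi>"
  shows "test_function a b (deriv \<phi>)"
proof -
  obtain K where K: "compact K" "K \<subseteq> {a<..<b}" "\<And>x. x \<notin> K \<Longrightarrow> \<phi> x = 0"
    using assms unfolding test_function_def by blast
  have "deriv \<phi> x = 0" if "x \<notin> K" for x
  proof -
    have "(\<phi> has_real_derivative 0) (at x)"
      using that K by (intro has_field_derivative_transform_within_open[OF DERIV_const[of "0::real"], where S = "- K"])
        (auto intro: compact_imp_closed)
    then show ?thesis by (rule DERIV_imp_deriv)
  qed
  moreover have "smooth_on UNIV (deriv \<phi>)"
    using assms unfolding test_function_def smooth_on_def by (metis comp_apply funpow_Suc_right)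
  ultimately show ?thesis
    using K unfolding test_function_def by blast
qed

lemma test_function_cmult:
  assumes "test_function a b \<phi>"
  shows "test_function a b (\<lambda>x. c * \<phi> x)" "deriv (\<lambda>x. c * \<phi> x) = (\<lambda>x. c * deriv \<phi> x)"
proof -
  have d: "(deriv ^^ k) \<phi> differentiable (at x)" for k x
    using assms unfolding test_function_def smooth_on_def by blast
  have eq: "(deriv ^^ k) (\<lambda>x. c * \<phi> x) = (\<lambda>x. c * (deriv ^^ k) \<phi> x)" for k
    by (induction k) (use d in \<open>auto intro!: ext deriv_cmult simp: field_differentiable_def real_differentiable_def\<close>)
  show "deriv (\<lambda>x. c * \<phi> x) = (\<lambda>x. c * deriv \<phi> x)"
    using eq[of 1] by simp
  show "test_function a b (\<lambda>x. c * \<phi> x)"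
    using assms d unfolding test_function_def smooth_on_def eq by (auto intro!: derivative_intros)
qed

lemma LINT_continuous_FTC:
  fixes f F :: "real \<Rightarrow> real"
  assumes "a \<le> b" "continuous_on {a..b} f"
    and "\<And>x. (F has_real_derivative f x) (at x)"
  shows "(LINT x|lebesgue_on {a<..<b}. f x) = F b - F a"
proof -
  have "(f has_integral F b - F a) {a..b}"
    using assms by (intro fundamental_theorem_of_calculus)
      (auto simp: has_real_derivative_iff_has_vector_derivative[symmetric] intro: has_field_derivative_at_within)
  then have "integral {a<..<b} f = F b - F a"
    by (simp only: integral_open_interval_real[symmetric] integral_unique)
  then show ?thesis
    using assms by (simp add: lebesgue_integral_eq_integral integrable_lebesgue_on_continuous)
qed

lemma test_function_has_weak_deriv:
  assumes "a \<le> b" "test_function a b \<psi>"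
  shows "has_weak_deriv a b \<psi> (deriv \<psi>)"
  unfolding has_weak_deriv_def
proof (intro allI impI)
  fix \<phi> assume \<phi>: "test_function a b \<phi>"
  note c = test_functionD[OF \<phi>] test_functionD[OF test_function_deriv[OF \<phi>]]
     test_functionD[OF assms(2)] test_functionD[OF test_function_deriv[OF assms(2)]]
  have i: "integrable (lebesgue_on {a<..<b}) (\<lambda>x. \<psi> x * deriv \<phi> x)"
     "integrable (lebesgue_on {a<..<b}) (\<lambda>x. deriv \<psi> x * \<phi> x)"
    by (intro integrable_lebesgue_on_continuous continuous_intros c)+
  have "(LINT x|lebesgue_on {a<..<b}. \<psi> x * deriv \<phi> x + deriv \<psi> x * \<phi> x) = \<psi> b * \<phi> b - \<psi> a * \<phi> a"
    using assms by (intro LINT_continuous_FTC)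
       (auto intro!: continuous_intros c derivative_eq_intros)
  also have "\<dots> = 0" using c(3)[of a] c(3)[of b] by simp
  finally show "(LINT x|lebesgue_on {a<..<b}. \<psi> x * deriv \<phi> x) = - (LINT x|lebesgue_on {a<..<b}. deriv \<psi> x * \<phi> x)"
    using i by simp
qed

lemma weak_deriv_unique:
  assumes "w \<in> L2 a b" "has_weak_deriv a b u w" "v \<in> L2 a b" "has_weak_deriv a b u v"
  shows "AE x in lebesgue_on {a<..<b}. w x = v x"
proof -
  have "AE x in lebesgue_on {a<..<b}. w x - v x = 0"
  proof (rule fundamental_lemma)
    fix \<phi> assume \<phi>: "test_function a b \<phi>"
    then have "\<phi> \<in> L2 a b" by (intro L2_continuous test_functionD)
    then have "integrable (lebesgue_on {a<..<b}) (\<lambda>x. w x * \<phi> x)" "integrable (lebesgue_on {a<..<b}) (\<lambda>x. v x * \<phi> x)"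
      using L2_integrable_mult[of _ a b \<phi> "\<lambda>_. 1" 1] assms by auto
    then show "(LINT x|lebesgue_on {a<..<b}. (w x - v x) * \<phi> x) = 0"
      using assms \<phi> unfolding has_weak_deriv_def by (simp add: left_diff_distrib)
  qed (use assms in \<open>simp add: L2_integrable\<close>)
  then show ?thesis by simp
qed

lemma weak_deriv_spec:
  assumes "u \<in> H1 a b"
  shows "weak_deriv a b u \<in> L2 a b" "has_weak_deriv a b u (weak_deriv a b u)"
  using assms someI_ex[of "\<lambda>w. w \<in> L2 a b \<and> has_weak_deriv a b u w"]
  unfolding H1_def weak_deriv_def by auto

lemma test_function_H1:
  assumes "a \<le> b" "test_function a b \<psi>" shows "\<psi> \<in> H1 a b"
  unfolding H1_def
  using test_function_has_weak_deriv[OF assms] L2_continuous test_functionD(2)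
    test_function_deriv assms(2) by blast

lemma weak_deriv_test_function:
  assumes "a \<le> b" "test_function a b \<psi>"
  shows "AE x in lebesgue_on {a<..<b}. weak_deriv a b \<psi> x = deriv \<psi> x"
  using weak_deriv_spec[OF test_function_H1[OF assms]] test_function_has_weak_deriv[OF assms]
    L2_continuous[OF test_functionD(2)[OF test_function_deriv[OF assms(2)]]]
  by (intro weak_deriv_unique)

text \<open>The constant sequence approximates \<open>\<psi>\<close>. That its \<open>H1_norm\<close> distance from \<open>\<psi>\<close> is \<open>0\<close> rests on the
  uniqueness of weak derivatives, since \<open>weak_deriv\<close> chooses an arbitrary weak derivative of the
  zero function.\<close>

lemma test_function_H10:
  assumes "a \<le> b" "test_function a b \<psi>" shows "\<psi> \<in> H10 a b"
proof -
  have z: "test_function a b (\<lambda>x. 0)" using test_function_cmult(1)[OF assms(2), of 0] by simp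
  have "(LINT x|lebesgue_on {a<..<b}. (weak_deriv a b (\<lambda>x. 0) x)\<^sup>2) = 0"
    using weak_deriv_test_function[OF assms(1) z]
    by (intro integral_eq_zero_AE) simp
  then have "H1_norm a b (\<lambda>x. \<psi> x - \<psi> x) = 0"
    by (simp add: H1_norm_def)
  then show ?thesis
    unfolding H10_def using test_function_H1[OF assms] assms test_functionD(2)[OF assms(2)]
    by (auto intro!: exI[of _ "\<lambda>_. \<psi>"])
qed

section \<open>The steady density\<close>

lemma smooth_onD:
  assumes "smooth_on {0<..} f"
  shows "z > 0 \<Longrightarrow> (f has_real_derivative deriv f z) (at z)"
    "continuous_on {0<..} f" "continuous_on {0<..} (deriv f)"
proof -
  have d: "(deriv ^^ k) f differentiable (at z)" if "z > 0" for k z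
    using assms that unfolding smooth_on_def by auto
  show "z > 0 \<Longrightarrow> (f has_real_derivative deriv f z) (at z)"
    using d[of z 0] by (simp add: DERIV_deriv_iff_real_differentiable)
  show "continuous_on {0<..} f" "continuous_on {0<..} (deriv f)"
    using d[of _ 0] d[of _ 1]
    by (auto intro!: continuous_at_imp_continuous_on differentiable_imp_continuous_within)
qed

lemma enthalpy_has_derivative:
  assumes "smooth_on {0<..} P" "z > 0"
  shows "(enthalpy P has_real_derivative deriv P z / z) (at z)"
proof -
  define c d where "c = min 1 z / 2" and "d = max 1 z + 1"
  have cd: "0 < c" "c < 1" "1 < d" "c < z" "z < d" using assms(2) by (auto simp: c_def d_def)
  have "((\<lambda>u. LBINT y=ereal 1..u. deriv P y / y) has_vector_derivative (deriv P z / z)) (at z within {c..d})"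
    using cd by (intro interval_integral_FTC2 continuous_intros continuous_on_subset[OF smooth_onD(3)[OF assms(1)]]) auto
  then have "(enthalpy P has_vector_derivative (deriv P z / z)) (at z within {c<..<d})"
    unfolding enthalpy_def[abs_def] one_ereal_def
    by (rule has_vector_derivative_within_subset) auto
  then show ?thesis
    using cd by (simp add: has_real_derivative_iff_has_vector_derivative has_vector_derivative_within_open[of z "{c<..<d}"])
qed

lemma continuous_on_enthalpy:
  assumes "smooth_on {0<..} P" shows "continuous_on {0<..} (enthalpy P)"
  using DERIV_isCont[OF enthalpy_has_derivative[OF assms]]
  by (intro continuous_at_imp_continuous_on) auto

lemma deriv_nonneg_if_strict_mono_on:
  assumes "smooth_on {0<..} P" "strict_mono_on {0<..} P" "z > 0"
  shows "deriv P z \<ge> 0"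
  using smooth_onD(1)[OF assms(1,3)] strict_mono_on_imp_mono_on[OF assms(2)]  assms(3)
  by (intro mono_on_imp_deriv_nonneg[where A = "{0<..}"]) (auto simp: interior_open)

text \<open>The derivative \<open>deriv P r / r\<close> could vanish at some points. On an interval \<open>{x..y}\<close>, however, it is at
  least \<open>deriv P r / y\<close>, so the enthalpy grows at least as much as the strictly increasing
  \<open>\<lambda>r. P r / y\<close>.\<close>

lemma strict_mono_on_enthalpy:
  assumes P: "smooth_on {0<..} P" "strict_mono_on {0<..} P"
  shows "strict_mono_on {0<..} (enthalpy P)"
proof (rule strict_mono_onI)
  fix x y :: real assume xy: "x \<in> {0<..}" "y \<in> {0<..}" "x < y"
  have "enthalpy P x - P x / y \<le> enthalpy P y - P y / y"
  proof (rule DERIV_nonneg_imp_nondecreasing[where f = "\<lambda>r. enthalpy P r - P r / y"])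
    fix r assume r: "x \<le> r" "r \<le> y"
    have "((\<lambda>r. enthalpy P r - P r / y) has_real_derivative deriv P r / r - deriv P r / y) (at r)"
      using xy r by (intro DERIV_diff DERIV_cdivide enthalpy_has_derivative smooth_onD P) auto
    moreover have "deriv P r / r - deriv P r / y \<ge> 0"
      using xy r deriv_nonneg_if_strict_mono_on[OF P, of r] by (simp add: frac_le)
    ultimately show "\<exists>d. ((\<lambda>r. enthalpy P r - P r / y) has_real_derivative d) (at r) \<and> 0 \<le> d" by blast
  qed (use xy in simp)
  moreover have "P x / y < P y / y"
    using strict_mono_onD[OF P(2) xy] xy by (simp add: divide_strict_right_mono)
  ultimately show "enthalpy P x < enthalpy P y" by simp
qed

lemma inv_into_strict_mono_continuous:
  fixes h :: "real \<Rightarrow> real"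
  assumes h: "continuous_on {0<..} h" "strict_mono_on {0<..} h" and a: "0 < a" "a \<le> b"
  shows "continuous_on {h a..h b} (inv_into {0<..} h)"
    and "inv_into {0<..} h ` {h a..h b} \<subseteq> {a..b}"
proof -
  have inv: "inv_into {0<..} h (h z) = z" if "z > 0" for z
    using that strict_mono_on_imp_inj_on[OF h(2)] by (simp add: inv_into_f_f)
  have sub: "{h a..h b} \<subseteq> h ` {a..b}"
  proof
    fix y assume "y \<in> {h a..h b}"
    then have "\<exists>x\<ge>a. x \<le> b \<and> h x = y"
      using a by (intro IVT' continuous_on_subset[OF h(1)]) auto
    then show "y \<in> h ` {a..b}" by auto
  qed
  have "continuous_on (h ` {a..b}) (inv_into {0<..} h)"
    using a inv by (intro continuous_on_inv continuous_on_subset[OF h(1)]) auto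
  then show "continuous_on {h a..h b} (inv_into {0<..} h)"
    using sub by (rule continuous_on_subset)
  have "inv_into {0<..} h ` {h a..h b} \<subseteq> inv_into {0<..} h ` h ` {a..b}"
    using sub by (rule image_mono)
  also have "\<dots> \<subseteq> {a..b}" using a inv by auto
  finally show "inv_into {0<..} h ` {h a..h b} \<subseteq> {a..b}" .
qed

text \<open>Used for the lower fluid on \<open>{-m..0}\<close> and for the upper fluid on \<open>{0..l}\<close>. Attainability of the
  enthalpy at both ends of the interval keeps the density in a compact subset of \<open>{0<..}\<close>.\<close>

lemma density_profile:
  fixes \<alpha> \<beta> :: real
  assumes P: "smooth_on {0<..} P" "strict_mono_on {0<..} P"
    and "g > 0" "\<rho> > 0" "\<alpha> \<le> \<beta>"
    and \<alpha>: "enthalpy P \<rho> - g * \<alpha> \<in> enthalpy P ` {0<..}"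
    and \<beta>: "enthalpy P \<rho> - g * \<beta> \<in> enthalpy P ` {0<..}"
  defines "r \<equiv> \<lambda>x. inv_into {0<..} (enthalpy P) (enthalpy P \<rho> - g * x)"
  shows "continuous_on {\<alpha>..\<beta>} r" "\<exists>c>0. \<forall>x\<in>{\<alpha>..\<beta>}. c \<le> r x" "r 0 = \<rho>"
proof -
  note mono = strict_mono_on_enthalpy[OF P] and cont = continuous_on_enthalpy[OF P(1)]
  obtain a b where ab: "a > 0" "b > 0" "enthalpy P \<rho> - g * \<beta> = enthalpy P a" "enthalpy P \<rho> - g * \<alpha> = enthalpy P b"
    using \<alpha> \<beta> by auto
  have "enthalpy P a \<le> enthalpy P b"
    using assms by (simp flip: ab(3,4))
  then have "a \<le> b"
    using strict_mono_onD[OF mono, of b a] ab by force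
  note inv = inv_into_strict_mono_continuous[OF cont mono ab(1) this]
  have maps: "enthalpy P \<rho> - g * x \<in> {enthalpy P a..enthalpy P b}" if "x \<in> {\<alpha>..\<beta>}" for x
    using that assms by (simp flip: ab(3,4))
  show "continuous_on {\<alpha>..\<beta>} r"
    unfolding r_def by (rule continuous_on_compose2[OF inv(1)]) (use maps in \<open>auto intro!: continuous_intros\<close>)
  show "\<exists>c>0. \<forall>x\<in>{\<alpha>..\<beta>}. c \<le> r x"
    using inv(2) maps ab(1) unfolding r_def by (intro exI[of _ a]) fastforce
  show "r 0 = \<rho>"
    using strict_mono_on_imp_inj_on[OF mono] assms(4) by (simp add: r_def inv_into_f_f)
qed

lemma two_sided_measurable_bounded:
  fixes f h :: "real \<Rightarrow> real"
  assumes f: "continuous_on {-m..0} f" and h: "continuous_on {0..l} h" and "m > 0" "l > 0"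
  shows "two_sided f h \<in> borel_measurable (lebesgue_on {-m<..<l})"
    and "\<exists>C. \<forall>x\<in>{-m<..<l}. \<bar>two_sided f h x\<bar> \<le> C"
proof -
  have "continuous_on {-m..l} (\<lambda>x. f (min x 0))" "continuous_on {-m..l} (\<lambda>x. h (max x 0))"
    using assms(3,4) by (auto intro!: continuous_on_compose2[OF f] continuous_on_compose2[OF h] continuous_intros)
  then have "(\<lambda>x. if x \<in> {..<0} then f (min x 0) else h (max x 0)) \<in> borel_measurable (lebesgue_on {-m<..<l})"
    by (intro measurable_If_set borel_measurable_lebesgue_on_continuous) (auto simp: sets_restrict_space_iff)
  moreover have "(\<lambda>x. if x \<in> {..<0} then f (min x 0) else h (max x 0)) = two_sided f h"
    by (auto simp: two_sided_def fun_eq_iff)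
  ultimately show "two_sided f h \<in> borel_measurable (lebesgue_on {-m<..<l})" by simp
  have "bounded (f ` {-m..0} \<union> h ` {0..l})"
    by (intro bounded_Un[THEN iffD2] conjI compact_imp_bounded compact_continuous_image f h) auto
  then obtain C where "\<And>y. y \<in> f ` {-m..0} \<union> h ` {0..l} \<Longrightarrow> \<bar>y\<bar> \<le> C"
    unfolding bounded_real by blast
  then show "\<exists>C. \<forall>x\<in>{-m<..<l}. \<bar>two_sided f h x\<bar> \<le> C"
    by (intro exI[of _ C]) (auto simp: two_sided_def)
qed

section \<open>The infimum of the energy as a function of the viscosity parameter\<close>

text \<open>The infimum \<open>\<mu>\<close> is nondecreasing because all slopes are nonnegative, and concave as an infimum of
  affine functions, hence continuous. Thus \<open>\<mu> s + s\<^sup>2\<close> is continuous and strictly increasing, and the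
  lower bound \<open>- B\<close> makes it nonnegative eventually. Near \<open>s = 0\<close> the single affine function of \<open>p0\<close>
  makes it nonpositive.\<close>

lemma unique_crossing_of_affine_infimum:
  fixes a d :: "'a \<Rightarrow> real"
  assumes lower: "\<And>p. p \<in> A \<Longrightarrow> - B \<le> a p" and d: "\<And>p. p \<in> A \<Longrightarrow> 0 \<le> d p"
    and neg: "p0 \<in> A" "a p0 < 0"
  shows "\<exists>!s. s > 0 \<and> (INF p\<in>A. a p + s * d p) = - s\<^sup>2"
proof -
  define \<mu> where "\<mu> s = (INF p\<in>A. a p + s * d p)" for s
  have ne: "A \<noteq> {}" using neg by auto
  have low: "- B \<le> a p + s * d p" if "p \<in> A" "s \<ge> 0" for p s
    using lower[OF that(1)] mult_nonneg_nonneg[OF that(2) d[OF that(1)]] by linarith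
  have bdd: "bdd_below ((\<lambda>p. a p + s * d p) ` A)" if "s \<ge> 0" for s
    using low that by (intro bdd_belowI2[of _ "- B"])
  have le: "\<mu> s \<le> a p + s * d p" if "p \<in> A" "s \<ge> 0" for p s
    unfolding \<mu>_def using that bdd by (intro cINF_lower)
  have ge: "- B \<le> \<mu> s" if "s \<ge> 0" for s
    unfolding \<mu>_def using ne low that by (intro cINF_greatest)
  have mono: "\<mu> s \<le> \<mu> t" if "0 \<le> s" "s \<le> t" for s t
    unfolding \<mu>_def[of t]
  proof (rule cINF_greatest[OF ne])
    fix p assume p: "p \<in> A"
    have "s * d p \<le> t * d p" using that d[OF p] by (intro mult_right_mono)
    then show "\<mu> s \<le> a p + t * d p" using le[OF p that(1)] by linarith
  qed
  have "convex_on {0<..} (\<lambda>s. - \<mu> s)"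
  proof (rule convex_onI)
    fix t s1 s2 :: real assume t: "0 < t" "t < 1" and s: "s1 \<in> {0<..}" "s2 \<in> {0<..}"
    have "(1 - t) * \<mu> s1 + t * \<mu> s2 \<le> \<mu> ((1 - t) * s1 + t * s2)"
      unfolding \<mu>_def[of "(1 - t) * s1 + t * s2"]
    proof (rule cINF_greatest[OF ne])
      fix p assume p: "p \<in> A"
      have "(1 - t) * \<mu> s1 + t * \<mu> s2 \<le> (1 - t) * (a p + s1 * d p) + t * (a p + s2 * d p)"
        using t s le[OF p] by (intro add_mono mult_left_mono) auto
      then show "(1 - t) * \<mu> s1 + t * \<mu> s2 \<le> a p + ((1 - t) * s1 + t * s2) * d p"
        by (simp add: algebra_simps)
    qed
    then show "- \<mu> ((1 - t) *\<^sub>R s1 + t *\<^sub>R s2) \<le> (1 - t) * - \<mu> s1 + t * - \<mu> s2" by simp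
  qed simp
  then have "continuous_on {0<..} (\<lambda>s. - \<mu> s)"
    by (intro convex_on_continuous) auto
  then have cont: "continuous_on {0<..} \<mu>"
    using continuous_on_minus[of "{0<..}" "\<lambda>s. - \<mu> s"] by simp
  \<comment> \<open>As \<open>s0\<^sup>2 \<le> s0\<close>, \<open>\<mu> s0 + s0\<^sup>2\<close> is at most \<open>a p0 + s0 * (d p0 + 1) \<le> a p0 / 2\<close>.\<close>
  define s0 where "s0 = min 1 (- a p0 / (2 * (d p0 + 1)))"
  have dp: "d p0 \<ge> 0" using d neg by auto
  have "s0 \<le> - a p0 / (2 * (d p0 + 1))" by (simp add: s0_def)
  then have s0: "0 < s0" "s0 \<le> 1" "s0 * (2 * (d p0 + 1)) \<le> - a p0"
    using neg dp by (auto simp: s0_def pos_le_divide_eq divide_simps)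
  have "s0\<^sup>2 \<le> s0" using s0 by (simp add: power2_eq_square mult_left_le)
  then have start: "\<mu> s0 + s0\<^sup>2 \<le> 0"
    using le[OF neg(1), of s0] s0 mult_nonneg_nonneg[OF less_imp_le[OF s0(1)] dp]
    unfolding distrib_left by linarith
  define T where "T = \<bar>B\<bar> + 1"
  have "T\<^sup>2 = \<bar>B\<bar>\<^sup>2 + 2 * \<bar>B\<bar> + 1" by (simp add: T_def power2_sum)
  then have T: "B \<le> T\<^sup>2" "s0 \<le> T"
    using s0 abs_ge_self[of B] abs_ge_zero[of B] zero_le_power2[of "\<bar>B\<bar>"] unfolding T_def by linarith+
  have "\<exists>s\<ge>s0. s \<le> T \<and> \<mu> s + s\<^sup>2 = 0"
    using start ge[of T] T s0
    by (intro IVT' continuous_on_add continuous_on_subset[OF cont] continuous_intros) auto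
  then obtain s where "s0 \<le> s" "\<mu> s + s\<^sup>2 = 0" by blast
  with s0 have s: "s > 0" "\<mu> s + s\<^sup>2 = 0" by auto
  have "t = s" if "t > 0" "\<mu> t + t\<^sup>2 = 0" for t
  proof (rule ccontr)
    have strict: "\<mu> x + x\<^sup>2 < \<mu> y + y\<^sup>2" if "0 < x" "x < y" for x y
      using mono[of x y] power_strict_mono[of x y 2] that by simp
    assume "t \<noteq> s"
    then show False using strict[of s t] strict[of t s] s that by force
  qed
  with s show ?thesis
    unfolding \<mu>_def[symmetric] eq_neg_iff_add_eq_0 by blast
qed

text \<open>What the variational argument needs to know about the steady state: the coefficients are
  measurable and bounded, and \<open>\<rho>0\<close> is bounded away from zero.\<close>

locale stratified_layer =
  fixes g \<sigma> m l k c0 C :: real and \<rho>0 dP \<epsilon> \<delta> :: "real \<Rightarrow> real"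
  assumes pos: "g > 0" "\<sigma> \<ge> 0" "m > 0" "l > 0" "k > 0" "c0 > 0"
    and meas: "\<rho>0 \<in> borel_measurable (lebesgue_on {-m<..<l})" "dP \<in> borel_measurable (lebesgue_on {-m<..<l})"
      "\<epsilon> \<in> borel_measurable (lebesgue_on {-m<..<l})" "\<delta> \<in> borel_measurable (lebesgue_on {-m<..<l})"
    and lower: "\<And>x. -m < x \<Longrightarrow> x < l \<Longrightarrow> c0 \<le> \<rho>0 x" "\<And>x. -m < x \<Longrightarrow> x < l \<Longrightarrow> 0 \<le> dP x"
      "\<And>x. -m < x \<Longrightarrow> x < l \<Longrightarrow> 0 \<le> \<epsilon> x" "\<And>x. -m < x \<Longrightarrow> x < l \<Longrightarrow> 0 \<le> \<delta> x"
    and upper: "\<And>x. -m < x \<Longrightarrow> x < l \<Longrightarrow> \<rho>0 x \<le> C" "\<And>x. -m < x \<Longrightarrow> x < l \<Longrightarrow> dP x \<le> C"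
      "\<And>x. -m < x \<Longrightarrow> x < l \<Longrightarrow> \<epsilon> x \<le> C" "\<And>x. -m < x \<Longrightarrow> x < l \<Longrightarrow> \<delta> x \<le> C"
begin

abbreviation "M \<equiv> lebesgue_on {-m<..<l}"
abbreviation "E \<equiv> energy g \<sigma> m l \<rho>0 dP \<epsilon> \<delta> k"

text \<open>The slope of the energy as a function of \<open>s\<close>.\<close>

definition dissipation :: "(real \<Rightarrow> real) \<Rightarrow> (real \<Rightarrow> real) \<Rightarrow> real" where
  "dissipation \<phi> \<psi> = (let \<phi>' = weak_deriv (-m) l \<phi>; \<psi>' = weak_deriv (-m) l \<psi> in
     1/2 * (LINT x|M. \<delta> x * (\<psi>' x + k * \<phi> x)\<^sup>2)
     + 1/2 * (LINT x|M. \<epsilon> x * ((\<phi>' x - k * \<psi> x)\<^sup>2 + (\<psi>' x - k * \<phi> x)\<^sup>2 + 1/3 * (\<psi>' x + k * \<phi> x)\<^sup>2)))"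

lemma rho_nonneg: "-m < x \<Longrightarrow> x < l \<Longrightarrow> 0 \<le> \<rho>0 x"
  using lower(1)[of x] pos by simp

lemma integrable_coeff_square:
  assumes "u \<in> L2 (-m) l" "c \<in> borel_measurable M"
    and "\<And>x. -m < x \<Longrightarrow> x < l \<Longrightarrow> 0 \<le> c x" "\<And>x. -m < x \<Longrightarrow> x < l \<Longrightarrow> c x \<le> D"
  shows "integrable M (\<lambda>x. c x * (u x)\<^sup>2)"
  unfolding power2_eq_square using assms by (intro L2_integrable_mult[where C = D]) auto

lemma H10_L2:
  assumes "u \<in> H10 (-m) l"
  shows "u \<in> L2 (-m) l" "weak_deriv (-m) l u \<in> L2 (-m) l"
  using assms weak_deriv_spec by (auto simp: H10_def H1_def)

lemma L2_linear: "u \<in> L2 (-m) l \<Longrightarrow> v \<in> L2 (-m) l \<Longrightarrow> (\<lambda>x. u x + c * v x) \<in> L2 (-m) l"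
   "u \<in> L2 (-m) l \<Longrightarrow> v \<in> L2 (-m) l \<Longrightarrow> (\<lambda>x. u x - c * v x) \<in> L2 (-m) l"
  using L2_add[of u "-m" l "\<lambda>x. c * v x"] L2_add[of u "-m" l "\<lambda>x. (-c) * v x"]
    L2_cmult[of v "-m" l c] L2_cmult[of v "-m" l "-c"] by auto

lemma integrable_terms:
  assumes "\<phi> \<in> H10 (-m) l" "\<psi> \<in> H10 (-m) l"
  shows "integrable M (\<lambda>x. dP x * \<rho>0 x * (weak_deriv (-m) l \<psi> x + k * \<phi> x)\<^sup>2)"
    "integrable M (\<lambda>x. \<delta> x * (weak_deriv (-m) l \<psi> x + k * \<phi> x)\<^sup>2)"
    "integrable M (\<lambda>x. \<rho>0 x * (\<phi> x * \<psi> x))"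
    "integrable M (\<lambda>x. \<rho>0 x * ((\<phi> x)\<^sup>2 + (\<psi> x)\<^sup>2))"
proof -
  note L = H10_L2[OF assms(1)] H10_L2[OF assms(2)]
  have "\<bar>\<rho>0 x\<bar> \<le> C" if "-m < x" "x < l" for x using rho_nonneg upper(1) that by fastforce
  then show "integrable M (\<lambda>x. \<rho>0 x * (\<phi> x * \<psi> x))"
    by (intro L2_integrable_mult L meas)
  show "integrable M (\<lambda>x. \<delta> x * (weak_deriv (-m) l \<psi> x + k * \<phi> x)\<^sup>2)"
    by (intro integrable_coeff_square[where D = C] L2_linear L meas lower upper)
  have "dP x * \<rho>0 x \<le> C * C" if "-m < x" "x < l" for x
    using that by (intro mult_mono) (auto intro: rho_nonneg lower upper order_trans[OF lower(2) upper(2)])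
  then show "integrable M (\<lambda>x. dP x * \<rho>0 x * (weak_deriv (-m) l \<psi> x + k * \<phi> x)\<^sup>2)"
    by (intro integrable_coeff_square[where D = "C * C"] L2_linear L borel_measurable_times meas)
       (auto intro!: mult_nonneg_nonneg rho_nonneg lower)
  show "integrable M (\<lambda>x. \<rho>0 x * ((\<phi> x)\<^sup>2 + (\<psi> x)\<^sup>2))"
    unfolding distrib_left
    by (intro Bochner_Integration.integrable_add integrable_coeff_square[where D = C] L meas rho_nonneg upper)
qed

lemma energy_affine:
  assumes "\<phi> \<in> H10 (-m) l" "\<psi> \<in> H10 (-m) l"
  shows "E s \<phi> \<psi> = E 0 \<phi> \<psi> + s * dissipation \<phi> \<psi>"
proof -
  note i = integrable_terms[OF assms]
  let ?v = "\<lambda>x. (weak_deriv (-m) l \<psi> x + k * \<phi> x)\<^sup>2"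
  let ?e = "\<lambda>x. \<epsilon> x * ((weak_deriv (-m) l \<phi> x - k * \<psi> x)\<^sup>2 + (weak_deriv (-m) l \<psi> x - k * \<phi> x)\<^sup>2 + 1/3 * ?v x)"
  have j: "integrable M (\<lambda>x. dP x * \<rho>0 x * ?v x - 2 * g * k * (\<rho>0 x * (\<phi> x * \<psi> x)))"
    using i by (intro Bochner_Integration.integrable_diff integrable_mult_right)
  have "(LINT x|M. (s * \<delta> x + dP x * \<rho>0 x) * ?v x - 2 * g * \<rho>0 x * k * \<phi> x * \<psi> x)
      = (LINT x|M. (dP x * \<rho>0 x * ?v x - 2 * g * k * (\<rho>0 x * (\<phi> x * \<psi> x))) + s * (\<delta> x * ?v x))"
    by (intro Bochner_Integration.integral_cong) (auto simp: algebra_simps)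
  also have "\<dots> = (LINT x|M. dP x * \<rho>0 x * ?v x - 2 * g * k * (\<rho>0 x * (\<phi> x * \<psi> x))) + s * (LINT x|M. \<delta> x * ?v x)"
    using j i by (subst Bochner_Integration.integral_add) auto
  finally have A: "(LINT x|M. (s * \<delta> x + dP x * \<rho>0 x) * ?v x - 2 * g * \<rho>0 x * k * \<phi> x * \<psi> x)
     = (LINT x|M. dP x * \<rho>0 x * ?v x - 2 * g * \<rho>0 x * k * \<phi> x * \<psi> x) + s * (LINT x|M. \<delta> x * ?v x)"
    by (simp add: mult_ac)
  have B: "(LINT x|M. s * \<epsilon> x * ((weak_deriv (-m) l \<phi> x - k * \<psi> x)\<^sup>2 + (weak_deriv (-m) l \<psi> x - k * \<phi> x)\<^sup>2 + 1/3 * ?v x))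
     = s * (LINT x|M. ?e x)"
    by (simp add: mult.assoc)
  show ?thesis
    unfolding energy_def dissipation_def Let_def A B by (simp add: algebra_simps)
qed

lemma dissipation_nonneg: "dissipation \<phi> \<psi> \<ge> 0"
  unfolding dissipation_def Let_def
  by (intro add_nonneg_nonneg mult_nonneg_nonneg integral_nonneg_AE AE_I2) (auto intro!: lower mult_nonneg_nonneg)

text \<open>Surface tension and compression contribute nonnegatively, and the gravity term is at least
  \<open>- g * k\<close> times the mass, by \<open>2 * \<phi> * \<psi> \<le> \<phi>\<^sup>2 + \<psi>\<^sup>2\<close>.\<close>

lemma energy_lower_bound:
  assumes "(\<phi>, \<psi>) \<in> admissible m l \<rho>0"
  shows "- (g * k) \<le> E 0 \<phi> \<psi>"
proof -
  have H: "\<phi> \<in> H10 (-m) l" "\<psi> \<in> H10 (-m) l" and mass: "(LINT x|M. \<rho>0 x * ((\<phi> x)\<^sup>2 + (\<psi> x)\<^sup>2)) = 2"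
    using assms by (auto simp: admissible_def mass_def)
  note i = integrable_terms[OF H]
  let ?v = "\<lambda>x. (weak_deriv (-m) l \<psi> x + k * \<phi> x)\<^sup>2"
  have "(LINT x|M. - (g * k) * (\<rho>0 x * ((\<phi> x)\<^sup>2 + (\<psi> x)\<^sup>2)))
      \<le> (LINT x|M. dP x * \<rho>0 x * ?v x - 2 * g * k * (\<rho>0 x * (\<phi> x * \<psi> x)))"
  proof (intro integral_mono Bochner_Integration.integrable_diff integrable_mult_right i)
    fix x assume "x \<in> space M"
    then have x: "-m < x" "x < l" by auto
    have "0 \<le> dP x * \<rho>0 x * ?v x" using x by (intro mult_nonneg_nonneg lower rho_nonneg) auto
    moreover have "(g * k * \<rho>0 x) * (2 * \<phi> x * \<psi> x) \<le> (g * k * \<rho>0 x) * ((\<phi> x)\<^sup>2 + (\<psi> x)\<^sup>2)"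
      using pos x by (intro mult_left_mono sum_squares_bound mult_nonneg_nonneg rho_nonneg) auto
    ultimately show "- (g * k) * (\<rho>0 x * ((\<phi> x)\<^sup>2 + (\<psi> x)\<^sup>2))
       \<le> dP x * \<rho>0 x * ?v x - 2 * g * k * (\<rho>0 x * (\<phi> x * \<psi> x))"
      by (simp add: algebra_simps)
  qed
  then have "- (g * k) * 2 \<le> (LINT x|M. dP x * \<rho>0 x * ?v x - 2 * g * \<rho>0 x * k * \<phi> x * \<psi> x)"
    by (simp add: mass mult_ac)
  moreover have "0 \<le> \<sigma> * k\<^sup>2 / 2 * (\<psi> 0)\<^sup>2" using pos by simp
  ultimately show ?thesis
    unfolding energy_def Let_def by simp
qed

lemma unique_growth_rate:
  assumes "(\<phi>, \<psi>) \<in> admissible m l \<rho>0" "E 0 \<phi> \<psi> < 0"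
  shows "\<exists>!s. s > 0 \<and> energy_inf g \<sigma> m l \<rho>0 dP \<epsilon> \<delta> k s = - s\<^sup>2"
proof -
  have eq: "energy_inf g \<sigma> m l \<rho>0 dP \<epsilon> \<delta> k s
     = (INF p\<in>admissible m l \<rho>0. (case p of (\<phi>, \<psi>) \<Rightarrow> E 0 \<phi> \<psi>) + s * (case p of (\<phi>, \<psi>) \<Rightarrow> dissipation \<phi> \<psi>))" for s
    unfolding energy_inf_def
    by (rule INF_cong) (auto simp: admissible_def energy_affine[of _ _ s])
  show ?thesis
    unfolding eq
    by (rule unique_crossing_of_affine_infimum[where B = "g * k" and ?p0.0 = "(\<phi>, \<psi>)"])
       (use assms energy_lower_bound dissipation_nonneg in auto)
qed

end

section \<open>A pair with negative inviscid energy\<close>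

lemma deriv_bump_symmetric:
  assumes "\<tau> > 0" "\<eta> > 0"
  shows "x < 0 \<Longrightarrow> deriv (bump \<tau> (-\<eta>) \<eta>) x \<ge> 0" "x > 0 \<Longrightarrow> deriv (bump \<tau> (-\<eta>) \<eta>) x \<le> 0"
proof -
  let ?q = "[:- (- \<eta>), 1:] * [:\<eta>, -1:]"
  have "deriv (bump \<tau> (-\<eta>) \<eta>) x =
      (if poly ?q x > 0 then \<tau> * (- 2 * x) / poly ?q x ^ 2 * exp (- \<tau> / poly ?q x) else 0)"
    using DERIV_imp_deriv[OF flat_exp_has_derivative[OF assms(1), of ?q 1 0 x]] bump_eq_flat_exp[of "-\<eta>" \<eta> \<tau>] assms
    by (simp add: flat_exp_def pderiv_mult pderiv_pCons algebra_simps power2_eq_square)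
  then show "x < 0 \<Longrightarrow> deriv (bump \<tau> (-\<eta>) \<eta>) x \<ge> 0" "x > 0 \<Longrightarrow> deriv (bump \<tau> (-\<eta>) \<eta>) x \<le> 0"
    using assms by (auto simp: mult_nonneg_nonneg mult_nonpos_nonneg divide_nonpos_nonneg mult_le_0_iff)
qed

text \<open>On each side of \<open>0\<close> the integrand is a constant multiple of the derivative of \<open>\<psi>\<^sup>2 / 2\<close>; the
  contributions of the outer endpoints vanish, and the two contributions at \<open>0\<close> leave the jump of
  the step function.\<close>

lemma integral_step_times_half_square_deriv:
  fixes r1 r2 :: real
  assumes \<psi>: "test_function (-m) l \<psi>" and "m > 0" "l > 0"
  defines "f \<equiv> \<lambda>x. (if x < 0 then r1 else r2) * (\<psi> x * deriv \<psi> x)"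
  shows "integrable (lebesgue_on {-m<..<l}) f"
    and "(LINT x|lebesgue_on {-m<..<l}. f x) = - (r2 - r1) * (\<psi> 0)\<^sup>2 / 2"
proof -
  note c = test_functionD[OF \<psi>] test_functionD[OF test_function_deriv[OF \<psi>]]
  have cont: "continuous_on S (\<lambda>x. r * (\<psi> x * deriv \<psi> x))" for S r
    by (intro continuous_intros c)
  have f_eq: "f = two_sided (\<lambda>x. r1 * (\<psi> x * deriv \<psi> x)) (\<lambda>x. r2 * (\<psi> x * deriv \<psi> x))"
    by (auto simp: f_def two_sided_def fun_eq_iff)
  obtain C where C: "f \<in> borel_measurable (lebesgue_on {-m<..<l})" "\<forall>x\<in>{-m<..<l}. \<bar>f x\<bar> \<le> C"
    using two_sided_measurable_bounded[OF cont cont assms(2,3)] unfolding f_eq by blast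
  show i: "integrable (lebesgue_on {-m<..<l}) f"
    using C by (intro Bochner_Integration.integrable_bound[OF integrable_lebesgue_on_continuous[of "-m" l "\<lambda>_. C"]])
      (auto intro!: AE_I2 order_trans[OF bspec[OF C(2)]])
  \<comment> \<open>A continuous antiderivative of \<open>f\<close> off \<open>0\<close>: each summand is constant on one side of \<open>0\<close>.\<close>
  define F where "F x = r1 * (\<psi> (min x 0))\<^sup>2 / 2 + r2 * (\<psi> (max x 0))\<^sup>2 / 2" for x
  have "(f has_integral F l - F (-m)) {-m..l}"
  proof (rule fundamental_theorem_of_calculus_interior_strong[of "{0}"])
    show "continuous_on {-m..l} F"
      unfolding F_def by (intro continuous_intros continuous_on_compose2[OF c(2)[of UNIV]]) auto
    fix x assume x: "x \<in> {-m<..<l} - {0}"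
    have d: "((\<lambda>x. r * (\<psi> x)\<^sup>2 / 2 + r') has_real_derivative r * (\<psi> x * deriv \<psi> x)) (at x)" for r r'
      by (auto intro!: derivative_eq_intros c)
    have "(F has_real_derivative f x) (at x)"
    proof (cases "x < 0")
      case True
      have "(F has_real_derivative r1 * (\<psi> x * deriv \<psi> x)) (at x)"
        by (rule has_field_derivative_transform_within_open[OF d[of r1 "r2 * (\<psi> 0)\<^sup>2 / 2"], where S = "{..<0}"])
          (use True in \<open>auto simp: F_def\<close>)
      then show ?thesis using True by (simp add: f_def)
    next
      case False
      have "(F has_real_derivative r2 * (\<psi> x * deriv \<psi> x)) (at x)"
        by (rule has_field_derivative_transform_within_open[OF d[of r2 "r1 * (\<psi> 0)\<^sup>2 / 2"], where S = "{0<..}"])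
          (use False x in \<open>auto simp: F_def\<close>)
      then show ?thesis using False by (simp add: f_def)
    qed
    then show "(F has_vector_derivative f x) (at x)"
      by (simp add: has_real_derivative_iff_has_vector_derivative)
  qed (use assms(2,3) in auto)
  then have "integral {-m<..<l} f = F l - F (-m)"
    by (simp only: integral_open_interval_real[symmetric] integral_unique)
  also have "\<dots> = - (r2 - r1) * (\<psi> 0)\<^sup>2 / 2"
    using c(3)[of l] c(3)[of "-m"] assms(2,3) by (simp add: F_def field_simps)
  finally show "(LINT x|lebesgue_on {-m<..<l}. f x) = - (r2 - r1) * (\<psi> 0)\<^sup>2 / 2"
    using i by (simp add: lebesgue_integral_eq_integral)
qed

context stratified_layer begin

text \<open>The choice \<open>\<phi> = - \<psi>' / k\<close> makes the compression \<open>\<psi>' + k * \<phi>\<close> vanish, so the internal energy does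
  not contribute.\<close>

lemma energy_0_test_function:
  assumes \<psi>: "test_function (-m) l \<psi>"
  shows "E 0 (\<lambda>x. - (1 / k) * deriv \<psi> x) \<psi>
      = \<sigma> * k\<^sup>2 / 2 * (\<psi> 0)\<^sup>2 + g * (LINT x|M. \<rho>0 x * (\<psi> x * deriv \<psi> x))"
proof -
  let ?\<phi> = "\<lambda>x. - (1 / k) * deriv \<psi> x"
  have w: "weak_deriv (-m) l \<psi> \<in> borel_measurable M"
    using H10_L2(2)[OF test_function_H10[OF _ \<psi>]] pos by (simp add: L2_def)
  have [measurable]: "\<psi> \<in> borel_measurable M" "deriv \<psi> \<in> borel_measurable M"
    using test_functionD(2)[OF \<psi>] test_functionD(2)[OF test_function_deriv[OF \<psi>]]
    by (auto intro: borel_measurable_lebesgue_on_continuous)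
  note [measurable] = meas w
  have "(LINT x|M. (0 * \<delta> x + dP x * \<rho>0 x) * (weak_deriv (-m) l \<psi> x + k * ?\<phi> x)\<^sup>2 - 2 * g * \<rho>0 x * k * ?\<phi> x * \<psi> x)
      = (LINT x|M. (2 * g) * (\<rho>0 x * (\<psi> x * deriv \<psi> x)))"
  proof (rule integral_cong_AE)
    show "AE x in M. (0 * \<delta> x + dP x * \<rho>0 x) * (weak_deriv (-m) l \<psi> x + k * ?\<phi> x)\<^sup>2 - 2 * g * \<rho>0 x * k * ?\<phi> x * \<psi> x
       = (2 * g) * (\<rho>0 x * (\<psi> x * deriv \<psi> x))"
      using weak_deriv_test_function[OF _ \<psi>] pos by (auto elim!: AE_mp)
  qed measurable
  then show ?thesis
    unfolding energy_def Let_def by simp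
qed

text \<open>Since \<open>\<psi> * \<psi>'\<close> is nonnegative below the interface and nonpositive above it, replacing the density
  by \<open>r1\<close> and \<open>r2\<close> there can only increase the energy. What remains is
  \<open>(\<sigma> * k\<^sup>2 - g * (r2 - r1)) * (\<psi> 0)\<^sup>2 / 2\<close>.\<close>

lemma energy_0_negative:
  assumes \<psi>: "test_function (-m) l \<psi>" "\<psi> 0 \<noteq> 0"
    and r: "\<And>x. -\<eta> < x \<Longrightarrow> x < 0 \<Longrightarrow> \<rho>0 x \<le> r1" "\<And>x. 0 < x \<Longrightarrow> x < \<eta> \<Longrightarrow> r2 \<le> \<rho>0 x"
    and jump: "\<sigma> * k\<^sup>2 < g * (r2 - r1)"
    and sign: "\<And>x. x < 0 \<Longrightarrow> 0 \<le> \<psi> x * deriv \<psi> x" "\<And>x. x > 0 \<Longrightarrow> \<psi> x * deriv \<psi> x \<le> 0"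
    and supp: "\<And>x. \<bar>x\<bar> \<ge> \<eta> \<Longrightarrow> \<psi> x = 0"
  shows "E 0 (\<lambda>x. - (1 / k) * deriv \<psi> x) \<psi> < 0"
proof -
  let ?s = "\<lambda>x. \<psi> x * deriv \<psi> x"
  note step = integral_step_times_half_square_deriv[OF \<psi>(1) pos(3,4), of r1 r2]
  have "\<psi> \<in> L2 (-m) l" "deriv \<psi> \<in> L2 (-m) l"
    using test_functionD(2)[OF \<psi>(1)] test_functionD(2)[OF test_function_deriv[OF \<psi>(1)]]
    by (auto intro: L2_continuous)
  moreover have "\<bar>\<rho>0 x\<bar> \<le> C" if "-m < x" "x < l" for x using rho_nonneg upper(1) that by fastforce
  ultimately have i: "integrable M (\<lambda>x. \<rho>0 x * ?s x)"
    by (intro L2_integrable_mult meas)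
  have null: "{0} \<in> null_sets (lebesgue_on {-m<..<l})"
    using pos by (intro null_sets_restrict_space[THEN iffD2]) auto
  have "(LINT x|M. \<rho>0 x * ?s x) \<le> (LINT x|M. (if x < 0 then r1 else r2) * ?s x)"
  proof (rule integral_mono_AE[OF i step(1)])
    show "AE x in M. \<rho>0 x * ?s x \<le> (if x < 0 then r1 else r2) * ?s x"
    proof (rule AE_I'[OF null], safe, rule ccontr)
      fix x assume x: "x \<in> space M" "\<not> \<rho>0 x * ?s x \<le> (if x < 0 then r1 else r2) * ?s x" "x \<noteq> 0"
      then have "\<bar>x\<bar> < \<eta>" using supp[of x] by force
      then show False
        using x r sign[of x] mult_right_mono[of "\<rho>0 x" r1 "?s x"] mult_right_mono_neg[of r2 "\<rho>0 x" "?s x"]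
        by (auto split: if_splits)
    qed
  qed
  then have "g * (LINT x|M. \<rho>0 x * ?s x) \<le> g * (- (r2 - r1) * (\<psi> 0)\<^sup>2 / 2)"
    using pos unfolding step(2) by (intro mult_left_mono) auto
  then have "E 0 (\<lambda>x. - (1 / k) * deriv \<psi> x) \<psi> \<le> (\<sigma> * k\<^sup>2 - g * (r2 - r1)) * ((\<psi> 0)\<^sup>2 / 2)"
    unfolding energy_0_test_function[OF \<psi>(1)] by (simp add: algebra_simps)
  also have "\<dots> < 0"
    using jump \<psi>(2) by (intro mult_neg_pos) auto
  finally show ?thesis .
qed

text \<open>A bump of half-width \<open>\<eta>\<close> around the interface, scaled to satisfy the constraint.\<close>

lemma exists_admissible_with_negative_energy:
  assumes \<eta>: "0 < \<eta>" "\<eta> < m" "\<eta> < l"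
    and r: "\<And>x. -\<eta> < x \<Longrightarrow> x < 0 \<Longrightarrow> \<rho>0 x \<le> r1" "\<And>x. 0 < x \<Longrightarrow> x < \<eta> \<Longrightarrow> r2 \<le> \<rho>0 x"
    and jump: "\<sigma> * k\<^sup>2 < g * (r2 - r1)"
  shows "\<exists>\<phi> \<psi>. (\<phi>, \<psi>) \<in> admissible m l \<rho>0 \<and> E 0 \<phi> \<psi> < 0"
proof -
  define b where "b = bump 1 (-\<eta>) \<eta>"
  have b: "test_function (-m) l b" unfolding b_def using \<eta> by (intro test_function_bump) auto
  have b0: "b 0 > 0" using \<eta> by (simp add: b_def bump_def)
  define \<phi> where "\<phi> = (\<lambda>x. - (1 / k) * deriv b x)"
  have \<phi>: "test_function (-m) l \<phi>"
    unfolding \<phi>_def by (intro test_function_cmult test_function_deriv b)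
  have H: "\<phi> \<in> H10 (-m) l" "b \<in> H10 (-m) l"
    using pos by (auto intro: test_function_H10 \<phi> b)
  have cont: "continuous_on {-m..l} (\<lambda>x. (b x)\<^sup>2)" by (intro continuous_intros test_functionD[OF b])
  have "0 < integral {-m..l} (\<lambda>x. (b x)\<^sup>2)"
  proof -
    have "integral {-m..l} (\<lambda>x. (b x)\<^sup>2) \<noteq> 0"
      using integral_eq_0_iff[of "-m" l "\<lambda>x. (b x)\<^sup>2", OF cont] pos b0 by force
    then show ?thesis using integral_nonneg[OF integrable_continuous_real[OF cont]] by force
  qed
  also have "\<dots> = (LINT x|M. (b x)\<^sup>2)"
    by (simp add: lebesgue_integral_eq_integral integrable_lebesgue_on_continuous[OF cont] integral_open_interval_real)
  finally have "0 < c0 * (LINT x|M. (b x)\<^sup>2)" using pos by simp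
  also have "\<dots> = (LINT x|M. c0 * (b x)\<^sup>2)" by simp
  also have "\<dots> \<le> (LINT x|M. \<rho>0 x * ((\<phi> x)\<^sup>2 + (b x)\<^sup>2))"
    using pos
    by (intro integral_mono integrable_terms H integrable_mult_right integrable_lebesgue_on_continuous[OF cont]
        mult_mono lower rho_nonneg) auto
  finally have mass_pos: "mass m l \<rho>0 \<phi> b > 0" by (simp add: mass_def)
  define A where "A = 1 / sqrt (mass m l \<rho>0 \<phi> b)"
  have A: "A > 0" "A\<^sup>2 * mass m l \<rho>0 \<phi> b = 1"
    using mass_pos by (auto simp: A_def power_divide)
  define \<psi> where "\<psi> = (\<lambda>x. A * b x)"
  have \<psi>: "test_function (-m) l \<psi>" "deriv \<psi> = (\<lambda>x. A * deriv b x)"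
    unfolding \<psi>_def by (intro test_function_cmult[OF b])+
  have A\<phi>: "(\<lambda>x. - (1 / k) * deriv \<psi> x) = (\<lambda>x. A * \<phi> x)"
    by (simp add: \<psi>(2) \<phi>_def fun_eq_iff)
  have "mass m l \<rho>0 (\<lambda>x. A * \<phi> x) \<psi> = A\<^sup>2 * mass m l \<rho>0 \<phi> b"
  proof -
    have "(LINT x|M. \<rho>0 x * ((A * \<phi> x)\<^sup>2 + (A * b x)\<^sup>2)) = (LINT x|M. A\<^sup>2 * (\<rho>0 x * ((\<phi> x)\<^sup>2 + (b x)\<^sup>2)))"
      by (intro Bochner_Integration.integral_cong) (auto simp: power_mult_distrib algebra_simps)
    then show ?thesis by (simp add: mass_def \<psi>_def)
  qed
  then have "((\<lambda>x. A * \<phi> x), \<psi>) \<in> admissible m l \<rho>0"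
    using A(2) pos by (auto simp: admissible_def intro!: test_function_H10 \<psi>(1) test_function_cmult \<phi>)
  moreover have "E 0 (\<lambda>x. - (1 / k) * deriv \<psi> x) \<psi> < 0"
  proof (rule energy_0_negative[OF \<psi>(1) _ r jump])
    show "\<psi> 0 \<noteq> 0" using A b0 by (simp add: \<psi>_def)
    have s: "\<psi> x * deriv \<psi> x = (A\<^sup>2 * b x) * deriv b x" for x
      by (simp add: \<psi>(2) power2_eq_square) (simp add: \<psi>_def)
    have nn: "A\<^sup>2 * b x \<ge> 0" for x
      using bump_bounds(1)[of 1 "-\<eta>" \<eta> x] by (simp add: b_def)
    show "0 \<le> \<psi> x * deriv \<psi> x" if "x < 0" for x
      unfolding s using deriv_bump_symmetric(1)[OF _ \<eta>(1) that, of 1]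
      by (intro mult_nonneg_nonneg nn) (simp add: b_def)
    show "\<psi> x * deriv \<psi> x \<le> 0" if "x > 0" for x
      unfolding s using deriv_bump_symmetric(2)[OF _ \<eta>(1) that, of 1]
      by (intro mult_nonneg_nonpos nn) (simp add: b_def)
    show "\<psi> x = 0" if "\<bar>x\<bar> \<ge> \<eta>" for x
      using that by (auto simp: \<psi>_def b_def bump_def)
  qed auto
  ultimately show ?thesis unfolding A\<phi> by blast
qed

end

section \<open>The fixed point\<close>

theorem theorem3p8:
  fixes g \<sigma> m l \<rho>m \<rho>p :: real
    and Pm Pp \<epsilon>m \<epsilon>p \<delta>m \<delta>p \<rho>0 dP \<epsilon>0 \<delta>0 :: "real \<Rightarrow> real"
    and \<xi> :: "real ^ 2"
    and \<mu> lam :: "real \<Rightarrow> real"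
    and S :: "real set"
  assumes "g > 0" "\<sigma> \<ge> 0" "m > 0" "l > 0"
    and "smooth_on {0<..} Pm" "smooth_on {0<..} Pp"
    and "\<forall>z>0. Pm z > 0" "\<forall>z>0. Pp z > 0"
    and "strict_mono_on {0<..} Pm" "strict_mono_on {0<..} Pp"
    and "(\<lambda>r. 1 / deriv Pm r) \<in> Linf_loc {0<..}" "(\<lambda>r. 1 / deriv Pp r) \<in> Linf_loc {0<..}"
    and "smooth_on {0<..} \<epsilon>m" "smooth_on {0<..} \<epsilon>p" "smooth_on {0<..} \<delta>m" "smooth_on {0<..} \<delta>p"
    and "\<forall>z>0. \<epsilon>m z > 0" "\<forall>z>0. \<epsilon>p z > 0" "\<forall>z>0. \<delta>m z \<ge> 0" "\<forall>z>0. \<delta>p z \<ge> 0"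
    and "\<rho>m \<in> {z. z > 0 \<and> Pm z > Pp z \<and> Pm z \<in> Pp ` {0<..}}"
    and "\<rho>p = inv_into {0<..} Pp (Pm \<rho>m)"
    and "enthalpy Pm \<rho>m + g * m \<in> enthalpy Pm ` {0<..}"
    and "enthalpy Pp \<rho>p - g * l \<in> enthalpy Pp ` {0<..}"
    and "\<rho>0 = steady_density g Pm Pp \<rho>m \<rho>p"
    and "dP = two_sided (\<lambda>x. deriv Pm (\<rho>0 x)) (\<lambda>x. deriv Pp (\<rho>0 x))"
    and "\<epsilon>0 = two_sided (\<lambda>x. \<epsilon>m (\<rho>0 x)) (\<lambda>x. \<epsilon>p (\<rho>0 x))"
    and "\<delta>0 = two_sided (\<lambda>x. \<delta>m (\<rho>0 x)) (\<lambda>x. \<delta>p (\<rho>0 x))"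
    and "0 < (norm \<xi>)\<^sup>2" "ereal ((norm \<xi>)\<^sup>2) < critical_sq g \<sigma> (\<rho>p - \<rho>m)"
    and "\<mu> = energy_inf g \<sigma> m l \<rho>0 dP \<epsilon>0 \<delta>0 (norm \<xi>)"
    and "S = {s. s > 0 \<and> \<mu> s < 0}"
    and "lam = (\<lambda>s. sqrt (- \<mu> s))"
  shows "\<exists>!s. s \<in> S \<and> lam s > 0 \<and> s = lam s"
proof -
  define k where "k = norm \<xi>"
  define rm where "rm = (\<lambda>x. inv_into {0<..} (enthalpy Pm) (enthalpy Pm \<rho>m - g * x))"
  define rp where "rp = (\<lambda>x. inv_into {0<..} (enthalpy Pp) (enthalpy Pp \<rho>p - g * x))"
  note g = assms(1) and \<sigma> = assms(2) and ml = assms(3,4)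
  have k: "k > 0" using assms(29) by (simp add: k_def)
  have \<rho>m: "\<rho>m > 0" "Pp \<rho>m < Pm \<rho>m" "Pm \<rho>m \<in> Pp ` {0<..}" using assms(21) by auto
  have "\<rho>p \<in> {0<..}" "Pp \<rho>p = Pm \<rho>m"
    unfolding assms(22) using \<rho>m(3) by (rule inv_into_into, rule f_inv_into_f)
  then have \<rho>p: "\<rho>p > 0" "\<rho>m < \<rho>p"
    using strict_mono_on_less[OF assms(10), of \<rho>m \<rho>p] \<rho>m by auto
  have rm: "continuous_on {-m..0} rm" "\<exists>c>0. \<forall>x\<in>{-m..0}. c \<le> rm x" "rm 0 = \<rho>m"
    unfolding rm_def using density_profile[OF assms(5,9) g \<rho>m(1), of "-m" 0] assms(23) ml \<rho>m(1) by auto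
  have rp: "continuous_on {0..l} rp" "\<exists>c>0. \<forall>x\<in>{0..l}. c \<le> rp x" "rp 0 = \<rho>p"
    unfolding rp_def using density_profile[OF assms(6,10) g \<rho>p(1), of 0 l] assms(24) ml \<rho>p(1) by auto
  obtain cm cp where c: "cm > 0" "cp > 0" "\<And>x. x \<in> {-m..0} \<Longrightarrow> cm \<le> rm x" "\<And>x. x \<in> {0..l} \<Longrightarrow> cp \<le> rp x"
    using rm(2) rp(2) by blast
  have \<rho>0_eq: "\<rho>0 = two_sided rm rp"
    unfolding assms(25) steady_density_def rm_def rp_def ..
  have r_pos: "rm x > 0" if "x \<in> {-m..0}" for x using c(1,3) that by fastforce
  have r_pos': "rp x > 0" if "x \<in> {0..l}" for x using c(2,4) that by fastforce
  \<comment> \<open>The three coefficients \<open>dP\<close>, \<open>\<epsilon>0\<close>, \<open>\<delta>0\<close> are all obtained by composing a continuous function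
    on \<open>{0<..}\<close> with the density on each side.\<close>
  have coeff: "two_sided (\<lambda>x. Fm (\<rho>0 x)) (\<lambda>x. Fp (\<rho>0 x)) \<in> borel_measurable (lebesgue_on {-m<..<l})"
      "\<exists>C. \<forall>x\<in>{-m<..<l}. \<bar>two_sided (\<lambda>x. Fm (\<rho>0 x)) (\<lambda>x. Fp (\<rho>0 x)) x\<bar> \<le> C"
      "\<And>x. x \<in> {-m<..<l} \<Longrightarrow> (\<And>z. z > 0 \<Longrightarrow> 0 \<le> Fm z) \<Longrightarrow> (\<And>z. z > 0 \<Longrightarrow> 0 \<le> Fp z) \<Longrightarrow>
         0 \<le> two_sided (\<lambda>x. Fm (\<rho>0 x)) (\<lambda>x. Fp (\<rho>0 x)) x"
    if F: "continuous_on {0<..} Fm" "continuous_on {0<..} Fp" for Fm Fp :: "real \<Rightarrow> real"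
  proof -
    have eq: "two_sided (\<lambda>x. Fm (\<rho>0 x)) (\<lambda>x. Fp (\<rho>0 x)) = two_sided (\<lambda>x. Fm (rm x)) (\<lambda>x. Fp (rp x))"
      by (auto simp: \<rho>0_eq two_sided_def fun_eq_iff)
    have "continuous_on {-m..0} (\<lambda>x. Fm (rm x))" "continuous_on {0..l} (\<lambda>x. Fp (rp x))"
      using r_pos r_pos' by (auto intro!: continuous_on_compose2[OF F(1) rm(1)] continuous_on_compose2[OF F(2) rp(1)])
    note * = two_sided_measurable_bounded[OF this ml]
    show "two_sided (\<lambda>x. Fm (\<rho>0 x)) (\<lambda>x. Fp (\<rho>0 x)) \<in> borel_measurable (lebesgue_on {-m<..<l})"
      "\<exists>C. \<forall>x\<in>{-m<..<l}. \<bar>two_sided (\<lambda>x. Fm (\<rho>0 x)) (\<lambda>x. Fp (\<rho>0 x)) x\<bar> \<le> C"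
      unfolding eq by (fact *)+
    show "0 \<le> two_sided (\<lambda>x. Fm (\<rho>0 x)) (\<lambda>x. Fp (\<rho>0 x)) x"
      if "x \<in> {-m<..<l}" "\<And>z. z > 0 \<Longrightarrow> 0 \<le> Fm z" "\<And>z. z > 0 \<Longrightarrow> 0 \<le> Fp z" for x
      unfolding eq two_sided_def using that r_pos[of x] r_pos'[of x] by auto
  qed
  note dP = coeff[OF smooth_onD(3)[OF assms(5)] smooth_onD(3)[OF assms(6)], folded assms(26)]
  note \<epsilon> = coeff[OF smooth_onD(2)[OF assms(13)] smooth_onD(2)[OF assms(14)], folded assms(27)]
  note \<delta> = coeff[OF smooth_onD(2)[OF assms(15)] smooth_onD(2)[OF assms(16)], folded assms(28)]
  note \<rho> = two_sided_measurable_bounded[OF rm(1) rp(1) ml, folded \<rho>0_eq]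
  obtain C1 C2 C3 C4 where C: "\<forall>x\<in>{-m<..<l}. \<bar>\<rho>0 x\<bar> \<le> C1" "\<forall>x\<in>{-m<..<l}. \<bar>dP x\<bar> \<le> C2"
      "\<forall>x\<in>{-m<..<l}. \<bar>\<epsilon>0 x\<bar> \<le> C3" "\<forall>x\<in>{-m<..<l}. \<bar>\<delta>0 x\<bar> \<le> C4"
    using \<rho>(2) dP(2) \<epsilon>(2) \<delta>(2) by blast
  interpret stratified_layer g \<sigma> m l k "min cm cp" "Max {C1, C2, C3, C4}" \<rho>0 dP \<epsilon>0 \<delta>0
  proof
    fix x assume x: "-m < x" "x < l"
    then have x': "x \<in> {-m<..<l}" by simp
    show "min cm cp \<le> \<rho>0 x"
      using c(3)[of x] c(4)[of x] x by (auto simp: \<rho>0_eq two_sided_def)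
    show "0 \<le> dP x"
      using dP(3)[OF x'] deriv_nonneg_if_strict_mono_on[OF assms(5,9)] deriv_nonneg_if_strict_mono_on[OF assms(6,10)] by blast
    show "0 \<le> \<epsilon>0 x" using \<epsilon>(3)[OF x'] assms(17,18) by (simp add: less_imp_le)
    show "0 \<le> \<delta>0 x" using \<delta>(3)[OF x'] assms(19,20) by simp
    show "\<rho>0 x \<le> Max {C1, C2, C3, C4}" "dP x \<le> Max {C1, C2, C3, C4}"
      "\<epsilon>0 x \<le> Max {C1, C2, C3, C4}" "\<delta>0 x \<le> Max {C1, C2, C3, C4}"
      using C[THEN bspec, OF x'] by (auto simp: le_max_iff_disj abs_le_iff)
  qed (use g \<sigma> ml k c(1,2) \<rho>(1) dP(1) \<epsilon>(1) \<delta>(1) in auto)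
  have crit: "\<sigma> * k\<^sup>2 < g * (\<rho>p - \<rho>m)"
    using assms(30) \<sigma> g \<rho>p by (auto simp: critical_sq_def k_def field_simps split: if_splits)
  \<comment> \<open>The density deviates by at most \<open>e\<close> on each side of the interface, which costs \<open>2 * g * e\<close>,
    half of the gap between the two sides of \<open>crit\<close>.\<close>
  define e where "e = (g * (\<rho>p - \<rho>m) - \<sigma> * k\<^sup>2) / (4 * g)"
  have e: "e > 0" using crit g by (simp add: e_def)
  have jump: "\<sigma> * k\<^sup>2 < g * ((\<rho>p - e) - (\<rho>m + e))"
  proof -
    have "g * e = (g * (\<rho>p - \<rho>m) - \<sigma> * k\<^sup>2) / 4" using g by (simp add: e_def)
    then show ?thesis using crit by (simp add: algebra_simps)
  qed
  obtain d1 where d1: "d1 > 0" "\<And>x. x \<in> {-m..0} \<Longrightarrow> \<bar>x\<bar> < d1 \<Longrightarrow> \<bar>rm x - \<rho>m\<bar> < e"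
    using rm(1)[unfolded continuous_on_iff, rule_format, of 0, OF _ e] ml rm(3) by (auto simp: dist_real_def)
  obtain d2 where d2: "d2 > 0" "\<And>x. x \<in> {0..l} \<Longrightarrow> \<bar>x\<bar> < d2 \<Longrightarrow> \<bar>rp x - \<rho>p\<bar> < e"
    using rp(1)[unfolded continuous_on_iff, rule_format, of 0, OF _ e] ml rp(3) by (auto simp: dist_real_def)
  define \<eta> where "\<eta> = Min {d1, d2, m, l} / 2"
  have \<eta>: "0 < \<eta>" "\<eta> < m" "\<eta> < l" "\<eta> < d1" "\<eta> < d2"
    using d1(1) d2(1) ml by (auto simp: \<eta>_def min_def)
  have near: "\<rho>0 x \<le> \<rho>m + e" if "-\<eta> < x" "x < 0" for x
    using d1(2)[of x] that \<eta> by (auto simp: \<rho>0_eq two_sided_def)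
  have near': "\<rho>p - e \<le> \<rho>0 x" if "0 < x" "x < \<eta>" for x
    using d2(2)[of x] that \<eta> by (auto simp: \<rho>0_eq two_sided_def)
  obtain \<phi> \<psi> where "(\<phi>, \<psi>) \<in> admissible m l \<rho>0" "E 0 \<phi> \<psi> < 0"
    using exists_admissible_with_negative_energy[OF \<eta>(1-3) near near' jump] by blast
  then have "\<exists>!s. s > 0 \<and> \<mu> s = - s\<^sup>2"
    unfolding assms(31) k_def[symmetric] by (rule unique_growth_rate)
  moreover have "s \<in> S \<and> lam s > 0 \<and> s = lam s \<longleftrightarrow> s > 0 \<and> \<mu> s = - s\<^sup>2" for s
  proof
    assume "s \<in> S \<and> lam s > 0 \<and> s = lam s"
    then have s: "s > 0" "\<mu> s < 0" and "s = sqrt (- \<mu> s)" by (auto simp only: assms(32,33))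
    then have "s\<^sup>2 = (sqrt (- \<mu> s))\<^sup>2" by (intro arg_cong[where f = "\<lambda>x. x\<^sup>2"])
    also have "\<dots> = - \<mu> s" using s(2) by simp
    finally show "s > 0 \<and> \<mu> s = - s\<^sup>2" using s(1) by simp
  next
    assume "s > 0 \<and> \<mu> s = - s\<^sup>2"
    then show "s \<in> S \<and> lam s > 0 \<and> s = lam s" by (simp add: assms(32,33))
  qed
  ultimately show ?thesis by simp
qed

end
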